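(* Every infinite 2-connected subcubic graph $G$ has a spanning subgraph that is a cactus and is faithful to $G$.
   Context: Subcubic means maximum degree at most 3. A (finite or infinite) cactus is a subcubic graph that is the union of a class $\mathcal{C}$ of cycles and a class $\mathcal{P}$ of paths such that (1) any two cycles in $\mathcal{C}$ are vertex-disjoint, (2) any two paths in $\mathcal{P}$ are vertex-disjoint, and (3) the graph obtained by contracting every cycle in $\mathcal{C}$ is a tree. A ray is a one-way infinite path; two rays of a graph $H$ are equivalent in $H$ if for every finite $S\subseteq V(H)$ some component of $H-S$ contains tails of both; the equivalence classes are the ends of $H$. A subgraph $F$ of $G$ is faithful to $G$ if (i) every end of $G$ contains a ray of $F$, and (ii) any two rays of $F$ are equivalent in $F$ if and only if they are equivalent in $G$. *)

theory Defs
  imports Main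
begin

text \<open>Simple undirected graphs: a vertex set V and a set E of 2-element vertex sets.\<close>

definition graph :: "'a set \<Rightarrow> 'a set set \<Rightarrow> bool" where
  "graph V E \<longleftrightarrow> (\<forall>e\<in>E. \<exists>u v. e = {u, v} \<and> u \<noteq> v \<and> u \<in> V \<and> v \<in> V)"

definition subcubic :: "'a set \<Rightarrow> 'a set set \<Rightarrow> bool" where
  "subcubic V E \<longleftrightarrow> (\<forall>v\<in>V. finite {e\<in>E. v \<in> e} \<and> card {e\<in>E. v \<in> e} \<le> 3)"

text \<open>Adjacency using only edges avoiding the vertex set S (i.e. the edges of G - S).\<close>

definition walk_rel :: "'a set set \<Rightarrow> 'a set \<Rightarrow> ('a \<times> 'a) set" where
  "walk_rel E S = {(u, v). {u, v} \<in> E \<and> u \<notin> S \<and> v \<notin> S}"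

text \<open>The subgraph induced on W (edges of E inside W) is connected (and nonempty).\<close>

definition connected_on :: "'a set \<Rightarrow> 'a set set \<Rightarrow> bool" where
  "connected_on W E \<longleftrightarrow> W \<noteq> {} \<and> (\<forall>x\<in>W. \<forall>y\<in>W. (x, y) \<in> (walk_rel E (- W))\<^sup>*)"

definition two_connected :: "'a set \<Rightarrow> 'a set set \<Rightarrow> bool" where
  "two_connected V E \<longleftrightarrow> (infinite V \<or> card V > 2) \<and>
     (\<forall>X. X \<subseteq> V \<and> finite X \<and> card X < 2 \<longrightarrow> connected_on (V - X) E)"

text \<open>Rays (one-way infinite paths), their equivalence, faithfulness.\<close>

definition is_ray :: "'a set \<Rightarrow> 'a set set \<Rightarrow> (nat \<Rightarrow> 'a) \<Rightarrow> bool" where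
  "is_ray V E r \<longleftrightarrow> inj r \<and> (\<forall>n. r n \<in> V \<and> {r n, r (Suc n)} \<in> E)"

definition rays_equiv :: "'a set \<Rightarrow> 'a set set \<Rightarrow> (nat \<Rightarrow> 'a) \<Rightarrow> (nat \<Rightarrow> 'a) \<Rightarrow> bool" where
  "rays_equiv V E r s \<longleftrightarrow>
     (\<forall>S. finite S \<and> S \<subseteq> V \<longrightarrow>
        (\<exists>k. \<forall>m\<ge>k. \<forall>n\<ge>k. r m \<notin> S \<and> s n \<notin> S \<and>
                (r m, s n) \<in> (walk_rel E (S \<union> - V))\<^sup>*))"

definition faithful :: "'a set \<Rightarrow> 'a set set \<Rightarrow> 'a set \<Rightarrow> 'a set set \<Rightarrow> bool" where
  "faithful VF EF V E \<longleftrightarrow>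
     (\<forall>r. is_ray V E r \<longrightarrow> (\<exists>s. is_ray VF EF s \<and> rays_equiv V E r s)) \<and>
     (\<forall>r s. is_ray VF EF r \<and> is_ray VF EF s \<longrightarrow>
        (rays_equiv VF EF r s \<longleftrightarrow> rays_equiv V E r s))"

text \<open>Finite cycles and finite paths, as subgraphs (vertex set, edge set).\<close>

definition cycle_edges :: "'a list \<Rightarrow> 'a set set" where
  "cycle_edges xs = {{xs ! i, xs ! (Suc i mod length xs)} | i. i < length xs}"

definition path_edges :: "'a list \<Rightarrow> 'a set set" where
  "path_edges xs = {{xs ! i, xs ! Suc i} | i. Suc i < length xs}"

definition is_cycle :: "'a set \<times> 'a set set \<Rightarrow> bool" where
  "is_cycle c \<longleftrightarrow> (\<exists>xs. distinct xs \<and> length xs \<ge> 3 \<and> fst c = set xs \<and> snd c = cycle_edges xs)"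

definition is_path :: "'a set \<times> 'a set set \<Rightarrow> bool" where
  "is_path p \<longleftrightarrow> (\<exists>xs. distinct xs \<and> xs \<noteq> [] \<and> fst p = set xs \<and> snd p = path_edges xs)"

text \<open>Contraction of a family C of disjoint cycles: each vertex is sent to the vertex set
  of its cycle, or to its singleton if it lies on no cycle. The contracted graph is a
  multigraph (loops and parallel edges kept) with vertex set the image of V and edge set the
  non-cycle edges.\<close>

definition contr_class :: "('a set \<times> 'a set set) set \<Rightarrow> 'a \<Rightarrow> 'a set" where
  "contr_class C v = {w. w = v \<or> (\<exists>c\<in>C. v \<in> fst c \<and> w \<in> fst c)}"

definition contr_rel :: "('a \<Rightarrow> 'b) \<Rightarrow> 'a set set \<Rightarrow> ('b \<times> 'b) set" where
  "contr_rel f F = {(f u, f v) | u v. {u, v} \<in> F}"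

definition mg_connected :: "'b set \<Rightarrow> ('b \<times> 'b) set \<Rightarrow> bool" where
  "mg_connected Q R \<longleftrightarrow> Q \<noteq> {} \<and> (\<forall>x\<in>Q. \<forall>y\<in>Q. (x, y) \<in> R\<^sup>*)"

text \<open>A (multi)graph is a tree iff it is minimally connected: connected, and deleting any
  edge disconnects it (a loop or a parallel edge never disconnects).\<close>

definition mg_tree :: "('a \<Rightarrow> 'b) \<Rightarrow> 'b set \<Rightarrow> 'a set set \<Rightarrow> bool" where
  "mg_tree f Q F \<longleftrightarrow> mg_connected Q (contr_rel f F) \<and>
     (\<forall>e\<in>F. \<not> mg_connected Q (contr_rel f (F - {e})))"

definition cactus :: "'a set \<Rightarrow> 'a set set \<Rightarrow> bool" where
  "cactus V E \<longleftrightarrow> graph V E \<and> subcubic V E \<and>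
     (\<exists>C P. (\<forall>c\<in>C. is_cycle c) \<and> (\<forall>p\<in>P. is_path p) \<and>
        (\<forall>c\<in>C. \<forall>c'\<in>C. c \<noteq> c' \<longrightarrow> fst c \<inter> fst c' = {}) \<and>
        (\<forall>p\<in>P. \<forall>p'\<in>P. p \<noteq> p' \<longrightarrow> fst p \<inter> fst p' = {}) \<and>
        V = (\<Union>c\<in>C. fst c) \<union> (\<Union>p\<in>P. fst p) \<and>
        E = (\<Union>c\<in>C. snd c) \<union> (\<Union>p\<in>P. snd p) \<and>
        mg_tree (contr_class C) (contr_class C ` V) (E - (\<Union>c\<in>C. snd c)))"

end

theory Submission
  imports Defs "HOL-Library.Countable_Set"
begin

text \<open>Start from a cycle and repeatedly cover part of a component \<open>K\<close> of what is left: hang a finite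
  path \<open>ps\<close> of \<open>K\<close> on an old cycle vertex, let it run until it meets the first vertex lying on a
  cycle of \<open>K\<close>, and add such a cycle. The invariant is that every remaining component sends at most
  one edge to old vertices off the cycles. As \<open>G\<close> is bridgeless, it then has a neighbour on an old
  cycle, so the process continues; if there is an edge to an off-cycle vertex, the path is
  directed towards it, which preserves the invariant. In the limit every vertex is covered, the
  cycles and the hung paths form a cactus, and the paths are disjoint because degrees are at
  most 3.

  For faithfulness, each path is hung on the most recently added cycle adjacent to \<open>K\<close>, as in a
  depth-first search. Given an end and a finite set \<open>S\<close>, consider the stages after the
  neighbours of \<open>S\<close> have been covered, and among them one where the newest cycle next to the
  component of the end is oldest. Everything later added in that component at the end descends from this
  cycle, outside \<open>S\<close>.\<close>

section \<open>Walks, components and circuits\<close>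

text \<open>Two obstacles shape a single step. The first is the invariant. A new component that
  touches the new path off its cycle does so by a bridge of the graph on the uncovered vertices. As
  the path heads for the old exceptional edge, the end of that edge in \<open>K\<close> lies on the
  other side of the bridge, so the new component again has only one exceptional edge. The second is
  that an infinite process need not cover every vertex. Each stage therefore has a target vertex,
  and the new cycle is chosen to get as far as possible along a shortest way to it. If the target is
  not covered, either the boundary of its component shrinks, or, by the degree bound and this
  choice, a single edge joins the component to the new vertices; the boundary then does not grow and
  the way becomes shorter. The depth-first rule fits: the new cycle is the newest one, so the next
  path may start on it. In faithfulness, equivalence in the subgraph gives equivalence in
  \<open>G\<close> at once. The work lies in the converse and in finding a ray in every end.\<close>

definition reach :: "'a set set \<Rightarrow> 'a set \<Rightarrow> ('a \<times> 'a) set" where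
  "reach F W = (walk_rel F (- W))\<^sup>*"

text \<open>\<open>reach\<close> is reflexive at every vertex, also outside \<open>W\<close>, so the
  component of a vertex outside \<open>W\<close> is its singleton. Membership of \<open>z\<close> in
  \<open>W\<close> is therefore stated wherever the component has to lie in
  \<open>W\<close>.\<close>

definition component :: "'a set set \<Rightarrow> 'a set \<Rightarrow> 'a \<Rightarrow> 'a set" where
  "component F W z = {y. (z, y) \<in> reach F W}"

definition walk :: "'a set set \<Rightarrow> 'a list \<Rightarrow> bool" where
  "walk F = successively (\<lambda>u v. {u, v} \<in> F)"

definition path_in :: "'a set set \<Rightarrow> 'a set \<Rightarrow> 'a \<Rightarrow> 'a list \<Rightarrow> 'a \<Rightarrow> bool" where
  "path_in F W x xs y \<longleftrightarrow>
     distinct xs \<and> xs \<noteq> [] \<and> hd xs = x \<and> last xs = y \<and> set xs \<subseteq> W \<and> walk F xs"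

definition circuit :: "'a set set \<Rightarrow> 'a list \<Rightarrow> bool" where
  "circuit F xs \<longleftrightarrow> distinct xs \<and> length xs \<ge> 3 \<and> walk F xs \<and> {last xs, hd xs} \<in> F"

definition boundary :: "'a set set \<Rightarrow> 'a set \<Rightarrow> 'a set set" where
  "boundary F K = {e \<in> F. e \<inter> K \<noteq> {} \<and> \<not> e \<subseteq> K}"

definition cross :: "'a set set \<Rightarrow> 'a set \<Rightarrow> 'a set \<Rightarrow> 'a set set" where
  "cross F K A = {e \<in> F. e \<inter> K \<noteq> {} \<and> e \<inter> A \<noteq> {}}"

definition at_most_one :: "'b set \<Rightarrow> bool" where
  "at_most_one S \<longleftrightarrow> (\<forall>x\<in>S. \<forall>y\<in>S. x = y)"

lemma at_most_oneD: "at_most_one S \<Longrightarrow> x \<in> S \<Longrightarrow> y \<in> S \<Longrightarrow> x = y"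
  by (simp add: at_most_one_def)

lemma walk_simps [simp]:
  "walk F []" "walk F [x]" "walk F (x # y # xs) \<longleftrightarrow> {x, y} \<in> F \<and> walk F (y # xs)"
  by (simp_all add: walk_def)

lemma walk_append_iff:
  "walk F (xs @ ys) \<longleftrightarrow> walk F xs \<and> walk F ys \<and> (xs = [] \<or> ys = [] \<or> {last xs, hd ys} \<in> F)"
  by (auto simp: walk_def successively_append_iff)

lemma walk_rev [simp]: "walk F (rev xs) \<longleftrightarrow> walk F xs"
  by (simp add: walk_def successively_rev insert_commute)

lemma walk_Cons: "walk F (x # xs) \<longleftrightarrow> walk F xs \<and> (xs = [] \<or> {x, hd xs} \<in> F)"
  by (cases xs) auto

lemma walk_mono: "walk F xs \<Longrightarrow> F \<subseteq> F' \<Longrightarrow> walk F' xs"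
  by (induction xs rule: induct_list012) auto

lemma walk_remove_edge: "walk F xs \<Longrightarrow> y \<notin> set xs \<Longrightarrow> walk (F - {{y, z}}) xs"
  by (induction xs rule: induct_list012) (auto simp: doubleton_eq_iff)

lemma reach_refl [simp]: "(x, x) \<in> reach F W"
  by (simp add: reach_def)

lemma reach_trans: "(x, y) \<in> reach F W \<Longrightarrow> (y, z) \<in> reach F W \<Longrightarrow> (x, z) \<in> reach F W"
  unfolding reach_def by (rule rtrancl_trans)

lemma reach_sym: "(x, y) \<in> reach F W \<Longrightarrow> (y, x) \<in> reach F W"
proof -
  have "sym (walk_rel F (- W))"
    by (auto simp: sym_def walk_rel_def insert_commute)
  then show "(x, y) \<in> reach F W \<Longrightarrow> (y, x) \<in> reach F W"
    unfolding reach_def by (meson sym_rtrancl symD)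
qed

lemma reach_edge: "{x, y} \<in> F \<Longrightarrow> x \<in> W \<Longrightarrow> y \<in> W \<Longrightarrow> (x, y) \<in> reach F W"
  unfolding reach_def by (auto simp: walk_rel_def)

lemma reach_mono: "(x, y) \<in> reach F W \<Longrightarrow> F \<subseteq> F' \<Longrightarrow> W \<subseteq> W' \<Longrightarrow> (x, y) \<in> reach F' W'"
  unfolding reach_def by (erule rtrancl_mono[THEN subsetD, rotated]) (auto simp: walk_rel_def)

lemma reach_induct [consumes 1, case_names refl step]:
  assumes "(x, y) \<in> reach F W" "P x"
    "\<And>y z. (x, y) \<in> reach F W \<Longrightarrow> {y, z} \<in> F \<Longrightarrow> y \<in> W \<Longrightarrow> z \<in> W \<Longrightarrow> P y \<Longrightarrow> P z"
  shows "P y"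
  using assms(1) unfolding reach_def
proof (induction rule: rtrancl_induct)
  case base
  then show ?case by (rule assms(2))
next
  case (step y z)
  then show ?case using assms(3)[of y z] by (auto simp: reach_def walk_rel_def)
qed

lemma reach_in: "(x, y) \<in> reach F W \<Longrightarrow> x \<in> W \<Longrightarrow> y \<in> W"
  by (induction rule: reach_induct) auto

lemma component_self [simp]: "z \<in> component F W z"
  by (simp add: component_def)

lemma component_subset: "z \<in> W \<Longrightarrow> component F W z \<subseteq> W"
  by (auto simp: component_def dest: reach_in)

lemma component_mono: "W \<subseteq> W' \<Longrightarrow> component F W z \<subseteq> component F W' z"
  by (auto simp: component_def intro: reach_mono)

lemma component_eq: "y \<in> component F W z \<Longrightarrow> component F W y = component F W z"
  by (auto simp: component_def intro: reach_trans reach_sym)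

lemma component_disjoint:
  "y \<notin> component F W z \<Longrightarrow> component F W y \<inter> component F W z = {}"
  by (auto simp: component_def intro: reach_trans reach_sym)

lemma component_edge:
  "y \<in> component F W z \<Longrightarrow> z \<in> W \<Longrightarrow> {y, y'} \<in> F \<Longrightarrow> y' \<in> W \<Longrightarrow> y' \<in> component F W z"
  using reach_trans[OF _ reach_edge, of z y F W y'] by (auto simp: component_def dest: reach_in)

lemma walk_reach_hd:
  "walk F xs \<Longrightarrow> set xs \<subseteq> W \<Longrightarrow> y \<in> set xs \<Longrightarrow> (hd xs, y) \<in> reach F W"
proof (induction xs)
  case (Cons x xs)
  show ?case
  proof (cases "y = x")
    case False
    then have "xs \<noteq> []" "(hd xs, y) \<in> reach F W"
      using Cons by (auto simp: walk_Cons)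
    moreover from this have "(x, hd xs) \<in> reach F W"
      using Cons.prems by (intro reach_edge) (auto simp: walk_Cons)
    ultimately show ?thesis by (auto intro: reach_trans)
  qed simp
qed simp

lemma walk_reach:
  "walk F xs \<Longrightarrow> set xs \<subseteq> W \<Longrightarrow> x \<in> set xs \<Longrightarrow> y \<in> set xs \<Longrightarrow> (x, y) \<in> reach F W"
  by (meson walk_reach_hd reach_sym reach_trans)

lemma path_in_reach: "path_in F W x xs y \<Longrightarrow> (x, y) \<in> reach F W"
  unfolding path_in_def by (metis walk_reach hd_in_set last_in_set)

lemma reach_path:
  assumes "(x, y) \<in> reach F W" "x \<in> W"
  obtains xs where "path_in F W x xs y"
proof -
  have "\<exists>xs. path_in F W x xs y"
    using assms(1)
  proof (induction rule: reach_induct)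
    case refl
    then have "path_in F W x [x] x"
      using assms(2) by (simp add: path_in_def)
    then show ?case by blast
  next
    case (step y z)
    then obtain xs where xs: "path_in F W x xs y" by blast
    show ?case
    proof (cases "z \<in> set xs")
      case True
      then obtain as bs where s: "xs = as @ z # bs" by (auto simp: in_set_conv_decomp)
      have "path_in F W x (as @ [z]) z"
        using xs walk_append_iff[of F "as @ [z]" bs] unfolding s path_in_def
        by (cases as) auto
      then show ?thesis by blast
    next
      case False
      then have "path_in F W x (xs @ [z]) z"
        using xs step unfolding path_in_def by (auto simp: walk_append_iff)
      then show ?thesis by blast
    qed
  qed
  then show ?thesis using that by blast
qed

lemma path_in_component:
  assumes "path_in F W x xs y"
  shows "set xs \<subseteq> component F W x"
  using assms unfolding path_in_def component_def by (metis walk_reach_hd mem_Collect_eq subsetI)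

lemma component_path:
  assumes "a \<in> component F W z" "b \<in> component F W z" "z \<in> W"
  obtains xs where "path_in F W a xs b" "set xs \<subseteq> component F W z"
proof -
  have "(a, b) \<in> reach F W" "a \<in> W"
    using assms by (auto simp: component_def intro: reach_trans reach_sym dest: reach_in)
  then obtain xs where "path_in F W a xs b" by (rule reach_path)
  then show ?thesis
    using that path_in_component component_eq[OF assms(1)] by metis
qed

lemma circuit_rotate:
  assumes "circuit F (as @ bs)"
  shows "circuit F (bs @ as)"
  using assms
  by (cases "as = []"; cases "bs = []") (auto simp: circuit_def walk_append_iff)

lemma circuit_at:
  assumes "circuit F xs" "y \<in> set xs"
  obtains ys where "circuit F (y # ys)" "set (y # ys) = set xs"
proof -
  obtain as bs where s: "xs = as @ y # bs"
    using assms(2) by (auto simp: in_set_conv_decomp)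
  then have "circuit F (y # (bs @ as))"
    using circuit_rotate[of F as "y # bs"] assms(1) by simp
  then show ?thesis using that[of "bs @ as"] s by auto
qed

lemma circuit_neighbours:
  assumes "circuit F xs" "y \<in> set xs"
  obtains a b where "a \<in> set xs" "b \<in> set xs" "a \<noteq> b" "a \<noteq> y" "b \<noteq> y" "{y, a} \<in> F" "{y, b} \<in> F"
proof -
  obtain ys where ys: "circuit F (y # ys)" "set (y # ys) = set xs"
    by (rule circuit_at[OF assms])
  then have l: "length ys \<ge> 2" "distinct (y # ys)" by (auto simp: circuit_def)
  then obtain a zs where zs: "ys = a # zs" "zs \<noteq> []"
    by (cases ys; cases "tl ys") auto
  define b where "b = last zs"
  have b: "b \<in> set zs" using zs by (simp add: b_def)
  have "{y, a} \<in> F" "{b, y} \<in> F"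
    using ys(1) zs by (simp_all add: circuit_def b_def)
  moreover have "a \<noteq> b" "a \<noteq> y" "b \<noteq> y" using l(2) b unfolding zs(1) by auto
  moreover have "a \<in> set xs" "b \<in> set xs" using ys(2) b unfolding zs(1) by auto
  ultimately show ?thesis using that[of a b] by (simp add: insert_commute)
qed

text \<open>\<open>b\<close> and \<open>c\<close> split the circuit into two arcs, and the detour
  through \<open>p\<close> closes either of them to a circuit. The arc containing \<open>w\<close>
  is kept. This later contradicts the choice of a cycle through \<open>w\<close> that reaches as far
  as possible.\<close>

lemma circuit_detour:
  assumes cs: "circuit F cs" and "c \<in> set cs" "b \<in> set cs" "c \<noteq> b" "w \<in> set cs"
    and p: "path_in F W k p h" and disj: "set p \<inter> set cs = {}"
    and e: "{b, k} \<in> F" "{h, c} \<in> F"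
  obtains Z where "circuit F Z" "w \<in> set Z" "h \<in> set Z" "set Z \<subseteq> set cs \<union> set p"
proof -
  obtain ys where ys: "circuit F (c # ys)" "set (c # ys) = set cs"
    by (rule circuit_at[OF cs assms(2)])
  then obtain A B where AB: "ys = A @ b # B"
    using assms by (metis in_set_conv_decomp set_ConsD)
  have p': "distinct p" "p \<noteq> []" "hd p = k" "last p = h" "walk F p"
    using p by (auto simp: path_in_def)
  have "length p > 0" using p' by simp
  have h: "h \<in> set p" using p' by auto
  have cyc: "distinct (c # A @ b # B)" "walk F (c # A @ b # B)" "{last (b # B), c} \<in> F"
    using ys(1) unfolding AB circuit_def by auto
  have sub: "set (c # A @ b # B) = set cs" using ys(2) AB by simp
  have w1: "walk F (c # A @ [b])" and w2: "walk F (b # B)"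
    using cyc(2) walk_append_iff[of F "c # A" "b # B"] walk_append_iff[of F "c # A" "[b]"] by auto
  show ?thesis
  proof (cases "w \<in> set (c # A @ [b])")
    case True
    have "walk F ((c # A @ [b]) @ p)"
      using w1 p' e by (subst walk_append_iff) auto
    then have "circuit F ((c # A @ [b]) @ p)"
      using cyc disj sub p' e \<open>length p > 0\<close> unfolding circuit_def by (auto simp: Suc_le_eq)
    then show ?thesis using that[of "(c # A @ [b]) @ p"] True h sub by auto
  next
    case False
    have "walk F ((b # B) @ c # rev p)"
      using w2 p' e cyc(3) by (subst walk_append_iff) (auto simp: walk_Cons hd_rev insert_commute)
    then have "circuit F ((b # B) @ c # rev p)"
      using cyc disj sub p' e \<open>length p > 0\<close>
      unfolding circuit_def by (auto simp: last_rev insert_commute Suc_le_eq)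
    moreover have "w \<in> set (b # B)" using False assms(5) sub by auto
    ultimately show ?thesis using that[of "(b # B) @ c # rev p"] h sub by auto
  qed
qed

text \<open>A path joining the ends of an edge without using it closes to a circuit with that
  edge.\<close>

lemma nonbridge_circuit:
  assumes r: "(y, z) \<in> reach (F - {{y, z}}) W" and e: "{y, z} \<in> F" "y \<noteq> z" "y \<in> W"
  obtains Z where "circuit F Z" "set Z \<subseteq> component F W y" "y \<in> set Z"
proof -
  obtain xs where xs: "path_in (F - {{y, z}}) W y xs z"
    by (rule reach_path[OF r e(3)])
  then have w: "walk F xs" "walk (F - {{y, z}}) xs"
    by (auto simp: path_in_def intro: walk_mono)
  then have 1: "path_in F W y xs z" using xs by (auto simp: path_in_def)
  obtain ys where ys: "xs = y # ys" using 1 by (cases xs) (auto simp: path_in_def)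
  obtain a zs where a: "ys = a # zs"
    using 1 e(2) ys by (cases ys) (auto simp: path_in_def)
  \<comment> \<open>A path with only two vertices would be the deleted edge itself.\<close>
  have "zs \<noteq> []" using xs unfolding ys a by (auto simp: path_in_def)
  then have "length xs \<ge> 3" unfolding ys a by (cases zs) auto
  then have "circuit F xs"
    using 1 e by (auto simp: circuit_def path_in_def insert_commute)
  moreover have "y \<in> set xs" using xs by (auto simp: path_in_def)
  ultimately show ?thesis using that path_in_component[OF 1] by blast
qed

section \<open>One step of the construction\<close>

locale infinite_subcubic =
  fixes V :: "'a set" and E :: "'a set set"
  assumes graph: "graph V E" and inf: "infinite V"
    and two: "two_connected V E" and sub: "subcubic V E"
begin

section \<open>Edges, the degree bound, and the covering of part of one component\<close>

lemma edge_in: "{a, b} \<in> E \<Longrightarrow> a \<in> V \<and> b \<in> V \<and> a \<noteq> b"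
  using graph unfolding graph_def by (metis doubleton_eq_iff)

lemma edgeE:
  assumes "e \<in> E" "k \<in> e"
  obtains b where "e = {k, b}" "b \<noteq> k"
  using assms graph unfolding graph_def by (metis empty_iff insert_commute insert_iff)

lemma boundaryE:
  assumes "e \<in> boundary E K"
  obtains k b where "e = {k, b}" "k \<in> K" "b \<notin> K" "{k, b} \<in> E"
proof -
  obtain k where k: "k \<in> e" "k \<in> K" "e \<in> E" using assms by (auto simp: boundary_def)
  obtain b where b: "e = {k, b}" using edgeE[OF k(3,1)] by blast
  then show ?thesis using that[OF b] assms k by (auto simp: boundary_def)
qed

lemma crossE:
  assumes "e \<in> cross E K A" "K \<inter> A = {}"
  obtains k a where "e = {k, a}" "k \<in> K" "a \<in> A" "{k, a} \<in> E"
proof -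
  obtain k where k: "k \<in> e" "k \<in> K" "e \<in> E" using assms(1) by (auto simp: cross_def)
  obtain b where b: "e = {k, b}" using edgeE[OF k(3,1)] by blast
  then have "b \<in> A" using assms k by (auto simp: cross_def)
  then show ?thesis using that b k by auto
qed

text \<open>Degree at most 3 enters the construction in this form: two cycle edges at a vertex leave
  room for one more edge only. This restricts how a component can be joined to a new cycle, and it
  keeps the paths disjoint.\<close>

lemma four_edges:
  assumes "{e1, e2, e3, e4} \<subseteq> E" "distinct [e1, e2, e3, e4]"
    "y \<in> e1" "y \<in> e2" "y \<in> e3" "y \<in> e4"
  shows False
proof -
  have "y \<in> V" using assms(1,3) graph by (auto simp: graph_def)
  then have f: "finite {e \<in> E. y \<in> e}" "card {e \<in> E. y \<in> e} \<le> 3"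
    using sub by (auto simp: subcubic_def)
  have "card {e1, e2, e3, e4} \<le> card {e \<in> E. y \<in> e}"
    using assms by (intro card_mono[OF f(1)]) auto
  moreover have "card {e1, e2, e3, e4} = 4" using assms(2) by simp
  ultimately show False using f(2) by simp
qed

lemma four_neighbours:
  assumes "{y, a} \<in> E" "{y, b} \<in> E" "{y, c} \<in> E" "{y, d} \<in> E" "distinct [a, b, c, d]"
  shows False
  by (rule four_edges[of "{y, a}" "{y, b}" "{y, c}" "{y, d}" y])
    (use assms in \<open>auto simp: doubleton_eq_iff\<close>)

text \<open>By \<open>acyc\<close> the edge between \<open>p1\<close> and \<open>k1\<close> is a
  bridge of the graph on \<open>W\<close>. Since \<open>p1\<close> lies in \<open>Q\<close>,
  connections inside \<open>W - Q\<close> never use it, so they stay on the side of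
  \<open>k1\<close>.\<close>

lemma outer_edge_step:
  assumes acyc: "(p1, k1) \<notin> reach (E - {{p1, k1}}) W"
    and "Q \<subseteq> W" "p1 \<in> Q" "z \<in> W - Q" "k1 \<in> component E (W - Q) z"
  shows "component E (W - Q) z \<inter> component (E - {{p1, k1}}) W p1 = {}"
proof (rule ccontr)
  assume "component E (W - Q) z \<inter> component (E - {{p1, k1}}) W p1 \<noteq> {}"
  then obtain y where y: "y \<in> component E (W - Q) z" "(p1, y) \<in> reach (E - {{p1, k1}}) W"
    by (auto simp: component_def)
  have "y \<in> component E (W - Q) k1" using y(1) component_eq[OF assms(5)] by simp
  then have "(k1, y) \<in> reach E (W - Q)" by (simp add: component_def)
  then have "(k1, y) \<in> reach (E - {{p1, k1}}) W"
  proof (induction rule: reach_induct)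
    case (step a b)
    then have "(a, b) \<in> reach (E - {{p1, k1}}) W"
      using \<open>p1 \<in> Q\<close> by (intro reach_edge) auto
    with step show ?case by (blast intro: reach_trans)
  qed simp
  then show False using y(2) acyc by (blast intro: reach_trans reach_sym)
qed

text \<open>\<open>W\<close> is the uncovered set, \<open>A\<close> the covered vertices off the
  cycles, \<open>u\<close> the vertex on which the path is hung, \<open>v\<close> the target. The
  new path follows a route \<open>\<sigma>\<close> chosen for the invariant, whereas
  \<open>\<pi>\<close> measures how far away \<open>v\<close> still is and governs the choice of the
  cycle. The last two conclusions are the invariant inside \<open>K\<close> and the progress towards
  \<open>v\<close>.\<close>

lemma step_exists:
  fixes W :: "'a set"
  assumes xW: "x \<in> W" and K: "K = component E W x"
    and \<pi>: "path_in E W x \<pi> v"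
    and A: "A \<inter> W = {}"
    and one: "at_most_one (cross E K A)"
    and u: "u \<notin> W" "{x, u} \<in> E" "u \<notin> A"
    and fin: "finite (boundary E K)"
  obtains ps cs Q where "Q = set ps \<union> set cs"
    "distinct ps" "ps \<noteq> []" "hd ps = x" "set ps \<subseteq> K" "walk E ps"
    "cs = [] \<or> circuit E cs \<and> set cs \<subseteq> K \<and> set ps \<inter> set cs = {last ps}"
    "\<forall>z\<in>K - Q. at_most_one (cross E (component E (W - Q) z) (A \<union> (set ps - set cs)))"
    "v \<notin> Q \<longrightarrow> card (boundary E (component E (W - Q) v)) < card (boundary E K) \<or>
       card (boundary E (component E (W - Q) v)) \<le> card (boundary E K) \<and>
       (\<exists>c\<in>set cs. \<exists>y \<pi>'. {y, c} \<in> E \<and> path_in E (W - Q) y \<pi>' v \<and> length \<pi>' < length \<pi>)"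
proof -
  have KW: "K \<subseteq> W" and xK: "x \<in> K" using component_subset[OF xW] K by auto
  have Kclosed: "b \<in> K" if "a \<in> K" "{a, b} \<in> E" "b \<in> W" for a b
    using that component_edge[of a E W x b] xW K by simp
  have KA: "K \<inter> A = {}" using A KW by auto
  have \<pi>K: "set \<pi> \<subseteq> K" using path_in_component[OF \<pi>] K by simp
  have \<pi>': "distinct \<pi>" "\<pi> \<noteq> []" "hd \<pi> = x" "last \<pi> = v" "walk E \<pi>"
    using \<pi> by (auto simp: path_in_def)
  have vK: "v \<in> K" using \<pi>K \<pi>' by auto

  \<comment> \<open>All edges from \<open>y\<close> into \<open>K\<close> are bridges of the graph
    on \<open>W\<close>: \<open>y\<close> lies on no cycle of \<open>K\<close>.\<close>
  define acyclic where "acyclic y \<longleftrightarrow> (\<forall>z\<in>K. {y, z} \<in> E \<longrightarrow> (y, z) \<notin> reach (E - {{y, z}}) W)" for y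

  \<comment> \<open>If an edge joins \<open>K\<close> to \<open>A\<close>, the route leads to its
    end in \<open>K\<close>; otherwise it is \<open>\<pi>\<close> itself. Hence it contains every
    vertex of \<open>K\<close> with a neighbour in \<open>A\<close>, and it contains
    \<open>v\<close> when there is none.\<close>
  obtain \<sigma> t where \<sigma>: "path_in E W x \<sigma> t"
    and \<sigma>A: "\<And>k a. {k, a} \<in> E \<Longrightarrow> k \<in> K \<Longrightarrow> a \<in> A \<Longrightarrow> k \<in> set \<sigma>"
    and \<sigma>v: "cross E K A = {} \<Longrightarrow> v \<in> set \<sigma>"
  proof (cases "cross E K A = {}")
    case True
    then have "\<not> ({k, a} \<in> E \<and> k \<in> K \<and> a \<in> A)" for k a by (auto simp: cross_def)
    moreover have "v \<in> set \<pi>" using \<pi>' by auto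
    ultimately show ?thesis using that[OF \<pi>] by blast
  next
    case False
    then obtain e where e: "e \<in> cross E K A" by blast
    obtain t a where t: "e = {t, a}" "t \<in> K" "a \<in> A" using crossE[OF e KA] by blast
    have "(x, t) \<in> reach E W" using t(2) K by (simp add: component_def)
    then obtain \<sigma> where s: "path_in E W x \<sigma> t" using reach_path[OF _ xW] by blast
    have "k \<in> set \<sigma>" if "{k, b} \<in> E" "k \<in> K" "b \<in> A" for k b
    proof -
      have "{k, b} \<in> cross E K A" using that by (auto simp: cross_def)
      then have "{k, b} = {t, a}" using at_most_oneD[OF one _ e] t(1) by simp
      then have "k = t" using that t KA by (auto simp: doubleton_eq_iff)
      then show ?thesis using s by (auto simp: path_in_def)
    qed
    then show ?thesis using that[OF s] False by blast
  qed
  have \<sigma>': "distinct \<sigma>" "\<sigma> \<noteq> []" "hd \<sigma> = x" "walk E \<sigma>" using \<sigma> by (auto simp: path_in_def)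
  have \<sigma>K: "set \<sigma> \<subseteq> K" using path_in_component[OF \<sigma>] K by simp

  have circ: "\<exists>Z. circuit E Z \<and> set Z \<subseteq> K \<and> w \<in> set Z" if w: "w \<in> K" "\<not> acyclic w" for w
  proof -
    obtain z where z: "z \<in> K" "{w, z} \<in> E" "(w, z) \<in> reach (E - {{w, z}}) W"
      using w by (auto simp: acyclic_def)
    have "component E W w = K" using w(1) K component_eq by metis
    then show ?thesis
      using nonbridge_circuit[OF z(3,2)] edge_in[OF z(2)] w(1) KW by (metis subsetD)
  qed

  obtain ps cs rest where \<sigma>eq: "\<sigma> = ps @ rest" and ps: "ps \<noteq> []"
    and cs: "cs = [] \<and> rest = [] \<or> circuit E cs \<and> set cs \<subseteq> K \<and> set ps \<inter> set cs = {last ps}"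
    and N: "\<And>p. p \<in> set ps - set cs \<Longrightarrow> acyclic p"
    and cmax: "\<And>Z i. \<lbrakk>cs \<noteq> []; circuit E Z; set Z \<subseteq> K; last ps \<in> set Z; i < length \<pi>; \<pi> ! i \<in> set Z\<rbrakk>
       \<Longrightarrow> \<exists>j<length \<pi>. i \<le> j \<and> \<pi> ! j \<in> set cs"
  proof (cases "\<forall>y\<in>set \<sigma>. acyclic y")
    case True
    show ?thesis by (rule that[of \<sigma> "[]" "[]"]) (use \<sigma>' True in auto)
  next
    case False
    then obtain ps' w rest where s: "\<sigma> = ps' @ w # rest" "\<not> acyclic w" "\<forall>y\<in>set ps'. acyclic y"
      using split_list_first_prop[of \<sigma> "\<lambda>y. \<not> acyclic y"] by blast
    have wK: "w \<in> K" using \<sigma>K s by auto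
    define good where "good Z \<longleftrightarrow> circuit E Z \<and> set Z \<subseteq> K \<and> w \<in> set Z" for Z
    \<comment> \<open>\<open>J\<close> collects the positions on \<open>\<pi>\<close> met by cycles
      of \<open>K\<close> through \<open>w\<close>. A cycle attaining the largest one is taken; if
      \<open>J\<close> is empty, any cycle through \<open>w\<close> will do.\<close>
    define J where "J = {i. i < length \<pi> \<and> (\<exists>Z. good Z \<and> \<pi> ! i \<in> set Z)}"
    have "finite J" unfolding J_def by simp
    obtain cs where c: "good cs" "\<forall>i\<in>J. \<exists>j<length \<pi>. i \<le> j \<and> \<pi> ! j \<in> set cs"
    proof (cases "J = {}")
      case True
      then show ?thesis using that circ[OF wK s(2)] by (auto simp: good_def)
    next
      case False
      then have "Max J \<in> J" using \<open>finite J\<close> by simp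
      then obtain Z where "good Z" "\<pi> ! Max J \<in> set Z" "Max J < length \<pi>" by (auto simp: J_def)
      then show ?thesis using that[of Z] Max_ge[OF \<open>finite J\<close>] by blast
    qed
    \<comment> \<open>A vertex of \<open>ps'\<close> on \<open>cs\<close> would have a cycle edge,
      which is no bridge because the rest of the cycle joins its ends.\<close>
    have "ps' \<noteq> [] \<Longrightarrow> set ps' \<inter> set cs = {}"
    proof (rule ccontr)
      assume "set ps' \<inter> set cs \<noteq> {}"
      then obtain y where y: "y \<in> set ps'" "y \<in> set cs" by auto
      have c': "circuit E cs" using c(1) by (simp add: good_def)
      obtain ys where ys: "circuit E (y # ys)" "set (y # ys) = set cs"
        by (rule circuit_at[OF c' y(2)])
      then have ysn: "ys \<noteq> []" "tl ys \<noteq> []" by (cases ys; cases "tl ys"; auto simp: circuit_def)+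
      have yh: "{y, hd ys} \<in> E" using ys ysn by (auto simp: circuit_def walk_Cons)
      have d: "distinct (y # ys)" "walk E ys" using ys by (auto simp: circuit_def walk_Cons)
      have "walk (E - {{y, hd ys}}) ys"
        using d by (intro walk_remove_edge) auto
      then have "(hd ys, last ys) \<in> reach (E - {{y, hd ys}}) K"
        using ys c(1) ysn by (intro walk_reach) (auto simp: good_def)
      moreover have "last ys \<noteq> hd ys"
      proof -
        obtain a zs where "ys = a # zs" "zs \<noteq> []" using ysn by (cases ys) auto
        then show ?thesis using d(1) by (auto dest: last_in_set)
      qed
      then have "(last ys, y) \<in> reach (E - {{y, hd ys}}) K"
        using ys c(1) ysn last_in_set[OF ysn(1)] d(1)
        by (intro reach_edge) (auto simp: circuit_def good_def doubleton_eq_iff)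
      ultimately have "(y, hd ys) \<in> reach (E - {{y, hd ys}}) W"
        using KW by (meson reach_mono reach_sym reach_trans order_refl)
      moreover have "hd ys \<in> K" using ys c(1) ysn hd_in_set[OF ysn(1)] by (auto simp: good_def)
      ultimately have "\<not> acyclic y" using yh by (auto simp: acyclic_def)
      then show False using s(3) y by auto
    qed
    then have disj: "set ps' \<inter> set cs = {}" by (cases "ps' = []") auto
    show ?thesis
    proof (rule that[of "ps' @ [w]" rest cs])
      show "\<exists>j<length \<pi>. i \<le> j \<and> \<pi> ! j \<in> set cs"
        if "circuit E Z" "set Z \<subseteq> K" "last (ps' @ [w]) \<in> set Z" "i < length \<pi>" "\<pi> ! i \<in> set Z" for Z i
        using that c(2) by (auto simp: J_def good_def)
    qed (use s c disj in \<open>auto simp: good_def\<close>)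
  qed

  define Q where "Q = set ps \<union> set cs"
  define N' where "N' = set ps - set cs"
  have psK: "set ps \<subseteq> K" using \<sigma>K \<sigma>eq by auto
  have QK: "Q \<subseteq> K" using psK cs by (auto simp: Q_def)
  have xps: "x \<in> set ps" and hdps: "hd ps = x" using \<sigma>' \<sigma>eq ps by auto
  have psd: "distinct ps" "walk E ps" using \<sigma>' \<sigma>eq by (auto simp: walk_append_iff)
  have compK: "component E (W - Q) z \<subseteq> K - Q" if "z \<in> K - Q" for z
  proof -
    have "component E (W - Q) z \<subseteq> component E W z" by (rule component_mono) auto
    also have "\<dots> = K" using that K component_eq by (metis DiffD1)
    finally show ?thesis using component_subset[of z "W - Q" E] that KW by blast
  qed

  text \<open>An edge from a new component to an acyclic vertex of \<open>ps\<close> is a bridge, so that component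
    lies apart from everything else that has been touched.\<close>
  have key: "k \<notin> component (E - {{p1, k1}}) W p1" "set \<sigma> \<union> Q \<subseteq> component (E - {{p1, k1}}) W p1"
    if z: "z \<in> K - Q" and k1: "k1 \<in> component E (W - Q) z" and p1: "p1 \<in> N'" and e: "{k1, p1} \<in> E"
      and k: "k \<in> component E (W - Q) z" for z k1 p1 k
  proof -
    have k1K: "k1 \<in> K" "k1 \<notin> Q" using compK[OF z] k1 by auto
    have e': "{k1, p1} = {p1, k1}" by auto
    have "acyclic p1" using N p1 by (auto simp: N'_def)
    then have nb: "(p1, k1) \<notin> reach (E - {{p1, k1}}) W"
      using k1K(1) e e' by (auto simp: acyclic_def)
    show "k \<notin> component (E - {{p1, k1}}) W p1"
      using outer_edge_step[OF nb, of Q z] QK KW p1 z k1 k by (auto simp: N'_def Q_def)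
    have p1ps: "p1 \<in> set ps" "p1 \<notin> set cs" using p1 by (auto simp: N'_def)
    have k1ps: "k1 \<notin> set ps" "k1 \<notin> set cs" using k1K by (auto simp: Q_def)
    have 1: "(p1, y) \<in> reach (E - {{p1, k1}}) W" if "y \<in> set ps" for y
      using walk_remove_edge[OF psd(2) k1ps(1), of p1] p1ps psK KW that e'
      by (intro walk_reach[of _ ps]) auto
    have l: "(p1, last ps) \<in> reach (E - {{p1, k1}}) W" using 1 ps by auto
    have 2: "(p1, y) \<in> reach (E - {{p1, k1}}) W" if "y \<in> set cs" for y
    proof -
      have c: "circuit E cs" "set cs \<subseteq> K" "last ps \<in> set cs" using cs that by auto
      then have "walk (E - {{p1, k1}}) cs"
        using walk_remove_edge p1ps by (auto simp: circuit_def)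
      then have "(last ps, y) \<in> reach (E - {{p1, k1}}) W"
        using c that KW by (intro walk_reach) auto
      with l show ?thesis by (rule reach_trans)
    qed
    have 3: "(p1, y) \<in> reach (E - {{p1, k1}}) W" if "y \<in> set rest" for y
    proof -
      have c: "last ps \<in> set cs" using cs that by auto
      then have "p1 \<notin> set (last ps # rest)" using p1ps \<sigma>' \<sigma>eq by auto
      moreover have "walk E (last ps # rest)"
        using \<sigma>' \<sigma>eq ps by (auto simp: walk_append_iff walk_Cons)
      ultimately have "walk (E - {{p1, k1}}) (last ps # rest)" by (intro walk_remove_edge)
      moreover have "last ps \<in> W" using last_in_set[OF ps] psK KW by blast
      ultimately have "(last ps, y) \<in> reach (E - {{p1, k1}}) W"
        using that \<sigma>K \<sigma>eq KW by (intro walk_reach[of _ "last ps # rest"]) auto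
      with l show ?thesis by (rule reach_trans)
    qed
    show "set \<sigma> \<union> Q \<subseteq> component (E - {{p1, k1}}) W p1"
      using 1 2 3 \<sigma>eq by (auto simp: component_def Q_def)
  qed
  \<comment> \<open>A second edge from the new component to \<open>Q\<close> would bypass the
    bridge.\<close>
  have unique: "k = k1 \<and> b = p1"
    if z: "z \<in> K - Q" and k1: "k1 \<in> component E (W - Q) z" and p1: "p1 \<in> N'" and e: "{k1, p1} \<in> E"
      and k: "k \<in> component E (W - Q) z" and b: "b \<in> Q" "{k, b} \<in> E" for z k1 p1 k b
  proof (rule ccontr)
    assume ne: "\<not> (k = k1 \<and> b = p1)"
    note key = key[OF z k1 p1 e k]
    have kQ: "k \<in> K" "k \<notin> Q" "k1 \<notin> Q" using compK[OF z] k k1 by auto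
    have "{b, k} \<noteq> {p1, k1}" using ne kQ b p1 by (auto simp: doubleton_eq_iff N'_def Q_def)
    then have "(b, k) \<in> reach (E - {{p1, k1}}) W"
      using b kQ QK KW by (intro reach_edge) (auto simp: insert_commute)
    moreover have "(p1, b) \<in> reach (E - {{p1, k1}}) W" using key(2) b by (auto simp: component_def)
    ultimately have "(p1, k) \<in> reach (E - {{p1, k1}}) W" by (blast intro: reach_trans)
    then show False using key(1) by (simp add: component_def)
  qed
  \<comment> \<open>The end in \<open>K\<close> of an edge to \<open>A\<close> lies on
    \<open>\<sigma>\<close>, hence on the far side of the bridge.\<close>
  have noA: "{k, a} \<notin> E"
    if z: "z \<in> K - Q" and k1: "k1 \<in> component E (W - Q) z" and p1: "p1 \<in> N'" and e: "{k1, p1} \<in> E"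
      and k: "k \<in> component E (W - Q) z" and a: "a \<in> A" for z k1 p1 k a
    using key[OF z k1 p1 e k] \<sigma>A[of k a] compK[OF z] k a by auto
  have outside: "b \<in> Q \<or> b \<notin> W"
    if "z \<in> K - Q" "k \<in> component E (W - Q) z" "{k, b} \<in> E" "b \<notin> component E (W - Q) z" for z k b
    using that component_edge[of k E "W - Q" z b] KW by auto
  have bW: "{k, b} \<in> boundary E K - {{x, u}}"
    if "z \<in> K - Q" "k \<in> component E (W - Q) z" "{k, b} \<in> E" "b \<notin> W" for z k b
  proof -
    have "k \<in> K" "k \<noteq> x" "b \<notin> K" "k \<noteq> u" using that compK[OF that(1)] xps KW u(1) by (auto simp: Q_def)
    then show ?thesis using that by (auto simp: boundary_def doubleton_eq_iff)
  qed
  have xu: "{x, u} \<in> boundary E K" using xK u KW by (auto simp: boundary_def)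

  have crossing: "e = e'" if z: "z \<in> K - Q"
    and e: "e \<in> cross E (component E (W - Q) z) (A \<union> N')"
    and e': "e' \<in> cross E (component E (W - Q) z) (A \<union> N')" for z e e'
  proof -
    have dis: "component E (W - Q) z \<inter> (A \<union> N') = {}"
      using compK[OF z] KA by (auto simp: N'_def Q_def)
    obtain k a where k: "e = {k, a}" "k \<in> component E (W - Q) z" "a \<in> A \<union> N'" "{k, a} \<in> E"
      using crossE[OF e dis] by blast
    obtain k' a' where k': "e' = {k', a'}" "k' \<in> component E (W - Q) z" "a' \<in> A \<union> N'" "{k', a'} \<in> E"
      using crossE[OF e' dis] by blast
    have NQ: "N' \<subseteq> Q" by (auto simp: N'_def Q_def)
    show ?thesis
    proof (cases "a \<in> N'")
      case True
      then have "a' \<in> N'" using noA[OF z k(2) True k(4) k'(2)] k' by auto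
      then show ?thesis using unique[OF z k(2) True k(4) k'(2)] k k' NQ by auto
    next
      case False
      show ?thesis
      proof (cases "a' \<in> N'")
        case True
        then show ?thesis using noA[OF z k'(2) True k'(4) k(2)] k False by auto
      next
        case n': False
        have "e \<in> cross E K A" "e' \<in> cross E K A"
          using k k' False n' compK[OF z] by (auto simp: cross_def)
        then show ?thesis by (rule at_most_oneD[OF one])
      qed
    qed
  qed

  have progress: "card (boundary E (component E (W - Q) v)) < card (boundary E K) \<or>
       card (boundary E (component E (W - Q) v)) \<le> card (boundary E K) \<and>
       (\<exists>c\<in>set cs. \<exists>y \<pi>'. {y, c} \<in> E \<and> path_in E (W - Q) y \<pi>' v \<and> length \<pi>' < length \<pi>)"
    if vQ: "v \<notin> Q"
  proof -
    have z: "v \<in> K - Q" using vQ vK by simp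
    let ?K' = "component E (W - Q) v"
    \<comment> \<open>Covering \<open>x\<close> removes \<open>{x, u}\<close> from the boundary,
      which pays for one new edge.\<close>
    have cardle: "card (boundary E ?K') \<le> card (boundary E K)"
      if h: "{h, c} \<in> E" and only: "\<And>k b. k \<in> ?K' \<Longrightarrow> b \<in> Q \<Longrightarrow> {k, b} \<in> E \<Longrightarrow> {k, b} = {h, c}" for h c
    proof -
      have "boundary E ?K' \<subseteq> insert {h, c} (boundary E K - {{x, u}})"
      proof
        fix e assume "e \<in> boundary E ?K'"
        then obtain k b where "e = {k, b}" "k \<in> ?K'" "b \<notin> ?K'" "{k, b} \<in> E" by (rule boundaryE)
        then show "e \<in> insert {h, c} (boundary E K - {{x, u}})"
          using outside[OF z, of k b] only[of k b] bW[OF z, of k b] by auto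
      qed
      then have "card (boundary E ?K') \<le> card (insert {h, c} (boundary E K - {{x, u}}))"
        using fin by (intro card_mono) auto
      also have "\<dots> \<le> Suc (card (boundary E K - {{x, u}}))" by (rule card_insert_le_m1) auto
      also have "\<dots> = card (boundary E K)"
        using xu fin by (metis card_Suc_Diff1)
      finally show ?thesis .
    qed
    show ?thesis
    proof (cases "\<exists>k1\<in>?K'. \<exists>p1\<in>N'. {k1, p1} \<in> E")
      case True
      then obtain k1 p1 where kp: "k1 \<in> ?K'" "p1 \<in> N'" "{k1, p1} \<in> E" by blast
      \<comment> \<open>The component of \<open>v\<close> hangs on the path by a bridge and misses
        \<open>\<sigma>\<close>. So the route was directed to \<open>A\<close>, and the edge
        \<open>f\<close> to \<open>A\<close> is lost along with \<open>{x, u}\<close>, against the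
        one new edge \<open>{k1, p1}\<close>.\<close>
      have "v \<notin> set \<sigma>" using key[OF z kp, of v] by auto
      then obtain f where f: "f \<in> cross E K A" using \<sigma>v by blast
      then obtain k a where fk: "f = {k, a}" "k \<in> K" "a \<in> A" "{k, a} \<in> E" by (rule crossE[OF _ KA])
      have fb: "f \<in> boundary E K" using fk KA by (auto simp: boundary_def)
      have fxu: "f \<noteq> {x, u}" using fk xK KA u by (auto simp: doubleton_eq_iff)
      have "boundary E ?K' \<subseteq> insert {k1, p1} (boundary E K - {{x, u}} - {f})"
      proof
        fix e assume "e \<in> boundary E ?K'"
        then obtain k b where kb: "e = {k, b}" "k \<in> ?K'" "b \<notin> ?K'" "{k, b} \<in> E" by (rule boundaryE)
        show "e \<in> insert {k1, p1} (boundary E K - {{x, u}} - {f})"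
        proof (cases "b \<in> Q")
          case True
          then show ?thesis using unique[OF z kp kb(2) True kb(4)] kb by auto
        next
          case False
          then have b: "b \<notin> W" using outside[OF z kb(2,4,3)] by simp
          have "b \<notin> A" using noA[OF z kp kb(2)] kb by auto
          then have "e \<noteq> f" using fk kb compK[OF z] KA by (auto simp: doubleton_eq_iff)
          then show ?thesis using bW[OF z kb(2,4) b] kb by auto
        qed
      qed
      then have "card (boundary E ?K') \<le> card (insert {k1, p1} (boundary E K - {{x, u}} - {f}))"
        using fin by (intro card_mono) auto
      also have "\<dots> \<le> Suc (card (boundary E K - {{x, u}} - {f}))" by (rule card_insert_le_m1) auto
      also have "\<dots> = card (boundary E K - {{x, u}})"
        using fb fxu fin by (intro card_Suc_Diff1) auto
      also have "\<dots> < card (boundary E K)"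
        using xu fin by (intro card_Diff1_less)
      finally show ?thesis by simp
    next
      case False
      \<comment> \<open>\<open>c\<close> will be the last vertex of \<open>\<pi>\<close> in
        \<open>Q\<close>. The remainder \<open>\<beta>\<close> then runs inside the component of
        \<open>v\<close> and is the shorter way.\<close>
      have "x \<in> Q" using xps by (simp add: Q_def)
      then have "\<exists>y\<in>set \<pi>. y \<in> Q" using \<pi>' by (metis hd_in_set)
      then obtain \<alpha> c \<beta> where sp: "\<pi> = \<alpha> @ c # \<beta>" "c \<in> Q" "\<forall>y\<in>set \<beta>. y \<notin> Q"
        using split_list_last_prop[of \<pi> "\<lambda>y. y \<in> Q"] by blast
      have \<beta>: "\<beta> \<noteq> []" "last \<beta> = v" using sp vQ \<pi>' by (auto split: if_splits)
      have \<beta>w: "walk E \<beta>" "{c, hd \<beta>} \<in> E" "distinct \<beta>" "set \<beta> \<subseteq> W - Q"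
        using sp \<pi>' \<beta> \<pi>K KW by (auto simp: walk_append_iff walk_Cons)
      define h where "h = hd \<beta>"
      have p\<beta>: "path_in E (W - Q) h \<beta> v" using \<beta> \<beta>w by (auto simp: path_in_def h_def)
      then have hK': "h \<in> ?K'" using path_in_reach reach_sym by (fastforce simp: component_def)
      have hc: "{h, c} \<in> E" using \<beta>w(2) by (simp add: h_def insert_commute)
      then have "c \<notin> N'" using False hK' by blast
      then have ccs: "c \<in> set cs" using sp(2) by (auto simp: Q_def N'_def)
      then have cs': "circuit E cs" "set cs \<subseteq> K" "last ps \<in> set cs" using cs by auto
      \<comment> \<open>A second edge at \<open>c\<close> would give \<open>c\<close> four
        neighbours, two of them on the cycle. An edge at another cycle vertex \<open>b\<close> would
        allow a detour: a circuit through \<open>last ps\<close> and \<open>h\<close>. As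
        \<open>h\<close> lies beyond \<open>c\<close> on \<open>\<pi>\<close>, this contradicts the
        choice of \<open>cs\<close>.\<close>
      have only: "{k, b} = {h, c}" if k: "k \<in> ?K'" and b: "b \<in> Q" and kb: "{k, b} \<in> E" for k b
      proof (rule ccontr)
        assume ne: "{k, b} \<noteq> {h, c}"
        have "b \<notin> N'" using False k kb by blast
        then have bcs: "b \<in> set cs" using b by (auto simp: Q_def N'_def)
        have kQ: "k \<notin> Q" "h \<notin> Q" using compK[OF z] k hK' by auto
        show False
        proof (cases "b = c")
          case True
          obtain a a' where "a \<in> set cs" "a' \<in> set cs" "a \<noteq> a'" "{c, a} \<in> E" "{c, a'} \<in> E"
            using circuit_neighbours[OF cs'(1) ccs] by metis
          moreover have "k \<noteq> h" "k \<notin> set cs" "h \<notin> set cs" using ne True kQ by (auto simp: Q_def)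
          moreover have "{c, k} \<in> E" "{c, h} \<in> E" using kb hc True by (simp_all add: insert_commute)
          ultimately show False using four_neighbours[of c a a' k h] by auto
        next
          case bc: False
          obtain p where p: "path_in E (W - Q) k p h" "set p \<subseteq> ?K'"
            using component_path[OF k hK'] z KW by blast
          have pd: "set p \<inter> set cs = {}" using p(2) compK[OF z] by (auto simp: Q_def)
          have "{b, k} \<in> E" using kb by (simp add: insert_commute)
          then obtain Z where Z: "circuit E Z" "last ps \<in> set Z" "h \<in> set Z" "set Z \<subseteq> set cs \<union> set p"
            using circuit_detour[OF cs'(1) ccs bcs bc[symmetric] cs'(3) p(1) pd _ hc] by blast
          have "set Z \<subseteq> K" using Z(4) cs'(2) p(2) compK[OF z] by blast
          moreover have "\<pi> ! Suc (length \<alpha>) = h" "Suc (length \<alpha>) < length \<pi>"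
            using sp(1) \<beta>(1) by (auto simp: h_def nth_append hd_conv_nth)
          moreover have "cs \<noteq> []" using ccs by auto
          ultimately obtain j where j: "j < length \<pi>" "Suc (length \<alpha>) \<le> j" "\<pi> ! j \<in> set cs"
            using cmax[of Z "Suc (length \<alpha>)"] Z by metis
          then have "\<pi> ! j \<in> set \<beta>" using sp(1)
            by (auto simp: nth_append nth_Cons' intro!: nth_mem)
          then show False using sp(3) j(3) by (auto simp: Q_def)
        qed
      qed
      have "length \<beta> < length \<pi>" using sp(1) by simp
      then show ?thesis using cardle[OF hc only] ccs hc p\<beta> by blast
    qed
  qed
  show ?thesis
    by (rule that[of Q ps cs])
      (use Q_def psd ps hdps psK cs crossing progress in \<open>auto simp: N'_def at_most_one_def\<close>)
qed

end

section \<open>The process\<close>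

type_synonym 'a step = "'a \<times> 'a list \<times> 'a list"

text \<open>A step \<open>(u, ps, cs)\<close> hangs the path \<open>ps\<close> on the old vertex \<open>u\<close>; unless \<open>cs = []\<close>, the last
  vertex of \<open>ps\<close> lies on the new cycle \<open>cs\<close>. Histories list the newest step first and start from a
  cycle \<open>c\<close>. The hubs are the vertices on cycles, the only ones on which later paths may be hung.\<close>

fun covered :: "'a list \<Rightarrow> 'a step list \<Rightarrow> 'a set" where
  "covered c [] = set c"
| "covered c ((u, ps, cs) # qs) = set ps \<union> set cs \<union> covered c qs"

fun hubs :: "'a list \<Rightarrow> 'a step list \<Rightarrow> 'a set" where
  "hubs c [] = set c"
| "hubs c ((u, ps, cs) # qs) = set cs \<union> hubs c qs"

fun rank :: "'a step list \<Rightarrow> 'a \<Rightarrow> nat" where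
  "rank [] y = 0"
| "rank ((u, ps, cs) # qs) y = (if y \<in> set ps \<union> set cs then Suc (length qs) else rank qs y)"

lemma finite_covered [simp]: "finite (covered c qs)"
  by (induction qs rule: covered.induct[where ?a0.0 = c]) auto

lemma hubs_subset_covered: "hubs c qs \<subseteq> covered c qs"
  by (induction c qs rule: hubs.induct) auto

lemma covered_mono: "covered c qs \<subseteq> covered c (q # qs)"
  by (cases q) auto

lemma rank_le: "rank qs y \<le> length qs"
  by (induction qs y rule: rank.induct) auto

context infinite_subcubic
begin

section \<open>Consequences of 2-connectedness and local finiteness\<close>

lemma reach_leaves:
  assumes "(a, b) \<in> reach E W" "a \<in> X" "a \<in> W" "b \<notin> X"
  obtains p q where "{p, q} \<in> E" "p \<in> X \<inter> W" "q \<in> W - X"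
proof -
  have "b \<in> X \<or> (\<exists>p q. {p, q} \<in> E \<and> p \<in> X \<inter> W \<and> q \<in> W - X)"
    using assms(1) by (induction rule: reach_induct) (use assms(2) in auto)
  then show ?thesis using that assms(4) by blast
qed

lemma reach_delete:
  assumes "X \<subseteq> V" "finite X" "card X < 2" "x \<in> V - X" "y \<in> V - X"
  shows "(x, y) \<in> reach E (V - X)"
  using assms two unfolding two_connected_def connected_on_def reach_def by blast

lemma reach_all: "x \<in> V \<Longrightarrow> y \<in> V \<Longrightarrow> (x, y) \<in> reach E V"
  using reach_delete[of "{}" x y] by simp

text \<open>Connectedness gives one boundary edge \<open>{p, q}\<close>. Deleting \<open>p\<close>,
  or \<open>q\<close> if \<open>X\<close> is just \<open>{p}\<close>, leaves a connected graph, in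
  which a further boundary edge must exist.\<close>

lemma two_boundary_edges:
  assumes X: "X \<subseteq> V" "X \<noteq> {}" "X \<noteq> V"
  obtains e e' where "e \<in> boundary E X" "e' \<in> boundary E X" "e \<noteq> e'"
proof -
  obtain a b where "a \<in> X" "b \<in> V - X" using X by auto
  then obtain p q where pq: "{p, q} \<in> E" "p \<in> X" "q \<in> V - X"
    using reach_leaves[OF reach_all[of a b], of X] X by blast
  have "\<exists>p' q'. {p', q'} \<in> E \<and> p' \<in> X \<and> q' \<notin> X \<and> {p', q'} \<noteq> {p, q}"
  proof (cases "X = {p}")
    case False
    then obtain a where a: "a \<in> X" "a \<noteq> p" using pq by auto
    then have "(a, q) \<in> reach E (V - {p})"
      using reach_delete[of "{p}" a q] pq X by auto
    then obtain p' q' where "{p', q'} \<in> E" "p' \<in> X \<inter> (V - {p})" "q' \<in> V - {p} - X"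
      using reach_leaves[of a q "V - {p}" X] a pq X by blast
    then show ?thesis by (intro exI[of _ p'] exI[of _ q']) (auto simp: doubleton_eq_iff)
  next
    case True
    \<comment> \<open>Deleting \<open>q\<close> helps only if some vertex outside \<open>X\<close>
      is left; infinity of \<open>V\<close> provides it.\<close>
    have "infinite (V - {p, q})" using inf by simp
    then obtain b where b: "b \<in> V - {p, q}" by (metis ex_in_conv finite.emptyI)
    then have "(p, b) \<in> reach E (V - {q})"
      using reach_delete[of "{q}" p b] pq X by auto
    then obtain p' q' where "{p', q'} \<in> E" "p' \<in> X \<inter> (V - {q})" "q' \<in> V - {q} - X"
      using reach_leaves[of p b "V - {q}" X] b pq X True by blast
    then show ?thesis by (intro exI[of _ p'] exI[of _ q']) (auto simp: doubleton_eq_iff)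
  qed
  then obtain p' q' where "{p', q'} \<in> E" "p' \<in> X" "q' \<notin> X" "{p', q'} \<noteq> {p, q}" by blast
  then show ?thesis using that[of "{p, q}" "{p', q'}"] pq by (auto simp: boundary_def)
qed

lemma finite_edges_at: "finite {e \<in> E. y \<in> e}"
proof (cases "y \<in> V")
  case True
  then show ?thesis using sub by (auto simp: subcubic_def)
next
  case False
  then have "{e \<in> E. y \<in> e} = {}" using graph by (auto simp: graph_def)
  then show ?thesis by (simp only: finite.emptyI)
qed

lemma finite_neighbours: "finite {z. {y, z} \<in> E}"
proof (rule finite_imageD)
  show "finite ((\<lambda>z. {y, z}) ` {z. {y, z} \<in> E})"
    by (rule finite_subset[OF _ finite_edges_at[of y]]) auto
qed (auto simp: inj_on_def doubleton_eq_iff)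

text \<open>A connected graph with finite degrees is countable. The enumeration lets every vertex
  become a target of the process.\<close>

lemma countable_vertices: "countable V"
proof -
  obtain v where v: "v \<in> V" using inf by fastforce
  have "countable (walk_rel E (- V) `` Y)" if "countable Y" for Y
  proof -
    have "countable (\<Union>y\<in>Y. {z. {y, z} \<in> E})"
      using that finite_neighbours by (intro countable_UN) (auto intro: countable_finite)
    then show ?thesis by (rule countable_subset[rotated]) (auto simp: walk_rel_def)
  qed
  then have "countable ((walk_rel E (- V))\<^sup>* `` {v})" by (intro countable_rtrancl) auto
  moreover have "V \<subseteq> (walk_rel E (- V))\<^sup>* `` {v}" using reach_all[OF v] by (auto simp: reach_def)
  ultimately show ?thesis by (rule countable_subset[rotated])
qed

text \<open>No edge is a bridge: otherwise, after its deletion, the component of one end would have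
  that edge as its only boundary edge.\<close>

lemma circuit_exists: obtains c where "circuit E c" "set c \<subseteq> V"
proof -
  obtain a where a: "a \<in> V" using inf by fastforce
  have "V \<noteq> {a}" using inf by auto
  then obtain e where "e \<in> boundary E {a}" using two_boundary_edges[of "{a}"] a by auto
  then obtain k b where "k \<in> {a}" "{k, b} \<in> E" by (rule boundaryE)
  then have b: "{a, b} \<in> E" "a \<noteq> b" "b \<in> V" using edge_in by auto
  let ?X = "component (E - {{a, b}}) V a"
  have "b \<in> ?X"
  proof (rule ccontr)
    assume nb: "b \<notin> ?X"
    have X: "?X \<subseteq> V" using component_subset[OF a] .
    have "e = {a, b}" if e: "e \<in> boundary E ?X" for e
    proof (rule ccontr)
      assume "e \<noteq> {a, b}"
      obtain k d where kd: "e = {k, d}" "k \<in> ?X" "d \<notin> ?X" "{k, d} \<in> E" using e by (rule boundaryE)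
      have "d \<in> ?X"
        by (rule component_edge[OF kd(2) a]) (use kd \<open>e \<noteq> {a, b}\<close> edge_in[OF kd(4)] in auto)
      then show False using kd by simp
    qed
    moreover have "?X \<noteq> {}" using component_self[of a] by blast
    ultimately show False using two_boundary_edges[OF X] nb b(3) by metis
  qed
  then have "(a, b) \<in> reach (E - {{a, b}}) V" by (simp add: component_def)
  then obtain Z where "circuit E Z" "set Z \<subseteq> component E V a"
    by (rule nonbridge_circuit[OF _ b(1,2) a])
  then show ?thesis using that component_subset[OF a] by blast
qed

lemma finite_boundary:
  assumes "finite H" "z \<in> V - H"
  shows "finite (boundary E (component E (V - H) z))"
proof (rule finite_subset)
  show "finite (\<Union>y\<in>H. {e \<in> E. y \<in> e})" using assms finite_edges_at by blast
  show "boundary E (component E (V - H) z) \<subseteq> (\<Union>y\<in>H. {e \<in> E. y \<in> e})"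
  proof
    fix e assume "e \<in> boundary E (component E (V - H) z)"
    then obtain k b where kb: "e = {k, b}" "k \<in> component E (V - H) z"
      "b \<notin> component E (V - H) z" "{k, b} \<in> E" by (rule boundaryE)
    then have "b \<in> H" using component_edge[OF kb(2) assms(2) kb(4)] edge_in[OF kb(4)] by auto
    then show "e \<in> (\<Union>y\<in>H. {e \<in> E. y \<in> e})" using kb by auto
  qed
qed

end

locale cactus_process = infinite_subcubic +
  fixes c :: "'a list"
  assumes c: "circuit E c" "set c \<subseteq> V"
begin

section \<open>Admissible steps, the invariant, and termination for each target\<close>

abbreviation rest_component :: "'a step list \<Rightarrow> 'a \<Rightarrow> 'a set" where
  "rest_component qs z \<equiv> component E (V - covered c qs) z"

text \<open>Along a run of the process, hubs of equal rank lie on the same cycle, so this selects a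
  cycle and leaves open which of its vertices adjacent to \<open>K\<close> is used.\<close>

definition newest :: "'a step list \<Rightarrow> 'a set \<Rightarrow> 'a \<Rightarrow> bool" where
  "newest qs K u \<longleftrightarrow> u \<in> hubs c qs \<and> (\<exists>x\<in>K. {x, u} \<in> E) \<and>
     (\<forall>u'\<in>hubs c qs. \<forall>z\<in>K. {z, u'} \<in> E \<longrightarrow> rank qs u' \<le> rank qs u)"

fun attach :: "'a step list \<Rightarrow> 'a step \<Rightarrow> bool" where
  "attach qs (u, ps, cs) \<longleftrightarrow>
     distinct ps \<and> ps \<noteq> [] \<and> walk E ps \<and> set ps \<subseteq> V - covered c qs \<and> {hd ps, u} \<in> E \<and>
     (cs = [] \<or> circuit E cs \<and> set cs \<subseteq> V - covered c qs \<and> set ps \<inter> set cs = {last ps}) \<and>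
     newest qs (rest_component qs (hd ps)) u"

definition invariant :: "'a step list \<Rightarrow> bool" where
  "invariant qs \<longleftrightarrow> set c \<subseteq> covered c qs \<and> covered c qs \<subseteq> V \<and>
     (\<forall>z\<in>V - covered c qs. at_most_one (cross E (rest_component qs z) (covered c qs - hubs c qs)))"

text \<open>The minimum runs over all admissible anchors and all their neighbours, so
  \<open>advance\<close> may pick a minimiser as its next start. Lengths count vertices.\<close>

definition dist :: "'a step list \<Rightarrow> 'a \<Rightarrow> nat" where
  "dist qs v = (LEAST l. \<exists>u x \<pi>. newest qs (rest_component qs v) u \<and> {x, u} \<in> E \<and>
     path_in E (V - covered c qs) x \<pi> v \<and> length \<pi> = l)"

text \<open>Lexicographic measure showing that a targeted vertex gets covered: if a step leaves its component
  next to an off-cycle vertex of the new path, the boundary shrinks; otherwise the component is left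
  through a single edge to the new cycle, and the way from there to the vertex is shorter.\<close>

definition pot :: "'a step list \<Rightarrow> 'a \<Rightarrow> nat \<times> nat" where
  "pot qs v = (card (boundary E (rest_component qs v)), dist qs v)"

text \<open>There are two boundary edges and at most one of them ends off the cycles, so another
  ends at a hub. Ranks are bounded by the number of steps, hence a largest one is attained.\<close>

lemma newest_exists:
  assumes inv: "invariant qs" and z: "z \<in> V - covered c qs"
  obtains u where "newest qs (rest_component qs z) u"
proof -
  let ?K = "rest_component qs z"
  have K: "?K \<subseteq> V - covered c qs" using component_subset[OF z] .
  have "c \<noteq> []" using c by (auto simp: circuit_def)
  then have "hd c \<in> set c" by simp
  then have "hd c \<in> V" "hd c \<notin> ?K" using K inv c(2) by (auto simp: invariant_def)
  then have "?K \<noteq> V" by blast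
  moreover have "?K \<noteq> {}" using component_self[of z] by blast
  ultimately obtain e e' where "e \<in> boundary E ?K" "e' \<in> boundary E ?K" "e \<noteq> e'"
    using two_boundary_edges[of ?K] K by blast
  then obtain e where e: "e \<in> boundary E ?K" "e \<notin> cross E ?K (covered c qs - hubs c qs)"
    using inv z unfolding invariant_def at_most_one_def by metis
  then obtain k b where kb: "e = {k, b}" "k \<in> ?K" "b \<notin> ?K" "{k, b} \<in> E" by (blast elim: boundaryE)
  have "b \<in> covered c qs" using component_edge[OF kb(2) z kb(4)] kb(3) edge_in[OF kb(4)] by auto
  then have "b \<in> hubs c qs" using e(2) kb by (auto simp: cross_def)
  then have "\<exists>u. (u \<in> hubs c qs \<and> (\<exists>x\<in>?K. {x, u} \<in> E)) \<and>
      (\<forall>u'. u' \<in> hubs c qs \<and> (\<exists>x\<in>?K. {x, u'} \<in> E) \<longrightarrow> rank qs u' \<le> rank qs u)"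
    using kb rank_le[of qs] by (intro ex_has_greatest_nat[of _ b _ "Suc (length qs)"]) (auto simp: le_imp_less_Suc)
  then show ?thesis using that unfolding newest_def by blast
qed

text \<open>The step starts at the pair \<open>u\<close>, \<open>x\<close> that attains
  \<open>dist qs v\<close>, so the length of \<open>\<pi>\<close> is the second entry of
  \<open>pot\<close>, and the progress statement of \<open>step_exists\<close> becomes a
  lexicographic decrease.\<close>

lemma advance:
  assumes inv: "invariant qs" and v: "v \<in> V - covered c qs"
  obtains q where "attach qs q" "invariant (q # qs)"
    "v \<in> covered c (q # qs) \<or> (pot (q # qs) v, pot qs v) \<in> less_than <*lex*> less_than"
proof -
  define W where "W = V - covered c qs"
  define A where "A = covered c qs - hubs c qs"
  have vW: "v \<in> W" using v by (simp add: W_def)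
  have HV: "covered c qs \<subseteq> V" "set c \<subseteq> covered c qs" using inv by (auto simp: invariant_def)
  define reachable where "reachable l \<longleftrightarrow> (\<exists>u x \<pi>. newest qs (rest_component qs v) u \<and> {x, u} \<in> E \<and>
     path_in E (V - covered c qs) x \<pi> v \<and> length \<pi> = l)" for l
  have "\<exists>l. reachable l"
  proof -
    obtain u where u: "newest qs (rest_component qs v) u" by (rule newest_exists[OF inv v])
    then obtain x where x: "x \<in> rest_component qs v" "{x, u} \<in> E" by (auto simp: newest_def)
    have xW: "x \<in> V - covered c qs" using component_subset[OF v] x(1) by blast
    have "(x, v) \<in> reach E (V - covered c qs)" using x(1) reach_sym by (fastforce simp: component_def)
    then obtain \<pi> where "path_in E (V - covered c qs) x \<pi> v" using reach_path xW by metis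
    then show ?thesis using u x(2) unfolding reachable_def by blast
  qed
  then have "reachable (LEAST l. reachable l)" by (rule LeastI_ex)
  then have "reachable (dist qs v)" unfolding dist_def reachable_def .
  then obtain u x \<pi> where u: "newest qs (rest_component qs v) u" "{x, u} \<in> E"
    and \<pi>: "path_in E W x \<pi> v" "length \<pi> = dist qs v"
    unfolding reachable_def W_def by blast
  have xW: "x \<in> W" using \<pi>(1) by (auto simp: path_in_def)
  define K where "K = component E W x"
  have "v \<in> K" using path_in_reach[OF \<pi>(1)] by (simp add: K_def component_def)
  then have Kv: "rest_component qs v = K" using component_eq K_def W_def by metis
  have uH: "u \<in> hubs c qs" using u by (simp add: newest_def)
  have AW: "A \<inter> W = {}" by (auto simp: A_def W_def)
  have uW: "u \<notin> W" "u \<notin> A" using uH hubs_subset_covered[of c qs] by (auto simp: W_def A_def)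
  have one: "at_most_one (cross E K A)"
    using inv v Kv unfolding invariant_def A_def by metis
  have fin: "finite (boundary E K)" using finite_boundary[of "covered c qs" v] v Kv by simp
  obtain ps cs Q where Q: "Q = set ps \<union> set cs"
    and ps: "distinct ps" "ps \<noteq> []" "hd ps = x" "set ps \<subseteq> K" "walk E ps"
    and cs: "cs = [] \<or> circuit E cs \<and> set cs \<subseteq> K \<and> set ps \<inter> set cs = {last ps}"
    and cross: "\<forall>z\<in>K - Q. at_most_one (cross E (component E (W - Q) z) (A \<union> (set ps - set cs)))"
    and prog: "v \<notin> Q \<longrightarrow> card (boundary E (component E (W - Q) v)) < card (boundary E K) \<or>
       card (boundary E (component E (W - Q) v)) \<le> card (boundary E K) \<and>
       (\<exists>c\<in>set cs. \<exists>y \<pi>'. {y, c} \<in> E \<and> path_in E (W - Q) y \<pi>' v \<and> length \<pi>' < length \<pi>)"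
    by (rule step_exists[OF xW K_def \<pi>(1) AW one uW(1) u(2) uW(2) fin]) (rule that)
  define q where "q = (u, ps, cs)"
  have KW: "K \<subseteq> W" using component_subset[OF xW] by (simp add: K_def)
  have psW: "set ps \<subseteq> W" and csW: "set cs \<subseteq> W" using ps cs KW by auto
  have W': "V - covered c (q # qs) = W - Q" by (auto simp: W_def Q q_def)
  have A': "covered c (q # qs) - hubs c (q # qs) = A \<union> (set ps - set cs)"
    using hubs_subset_covered[of c qs] psW csW by (auto simp: A_def W_def q_def)
  have att: "attach qs q"
    using ps cs psW csW u Kv K_def unfolding q_def W_def by auto
  have "invariant (q # qs)"
    unfolding invariant_def W' A'
  proof (intro conjI ballI)
    show "set c \<subseteq> covered c (q # qs)" "covered c (q # qs) \<subseteq> V"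
      using HV psW csW by (auto simp: q_def W_def)
    fix z assume z: "z \<in> W - Q"
    show "at_most_one (cross E (component E (W - Q) z) (A \<union> (set ps - set cs)))"
    proof (cases "z \<in> K")
      case True
      then show ?thesis using cross z by blast
    next
      case False
      \<comment> \<open>The component of \<open>z\<close> is separated from \<open>K\<close>, so it
        has no edge to the new path and its old bound carries over.\<close>
      have dis: "component E W z \<inter> K = {}"
        unfolding K_def by (rule component_disjoint) (use False in \<open>simp add: K_def\<close>)
      have sub: "component E (W - Q) z \<subseteq> component E W z" by (rule component_mono) auto
      have zW: "component E W z \<subseteq> W" using component_subset[of z W E] z by blast
      have "d \<in> cross E (component E W z) A"
        if d: "d \<in> cross E (component E (W - Q) z) (A \<union> (set ps - set cs))" for d
      proof -
        have "component E (W - Q) z \<inter> (A \<union> (set ps - set cs)) = {}"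
          using sub dis zW AW ps(4) by blast
        from crossE[OF d this] obtain k a where ka: "d = {k, a}" "k \<in> component E (W - Q) z"
          "a \<in> A \<union> (set ps - set cs)" "{k, a} \<in> E" by blast
        have "a \<notin> set ps"
        proof
          assume "a \<in> set ps"
          then have "a \<in> W" "a \<in> K" using psW ps by auto
          then have "a \<in> component E W z"
            using component_edge[of k E W z a] ka sub z by blast
          then show False using dis \<open>a \<in> K\<close> by blast
        qed
        then show ?thesis using ka sub by (auto simp: cross_def)
      qed
      then show ?thesis using inv z unfolding invariant_def A_def W_def at_most_one_def by blast
    qed
  qed
  moreover have "v \<in> covered c (q # qs) \<or> (pot (q # qs) v, pot qs v) \<in> less_than <*lex*> less_than"
  proof (cases "v \<in> covered c (q # qs)")
    case False
    then have vQ: "v \<notin> Q" by (auto simp: q_def Q)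
    have pot: "pot qs v = (card (boundary E K), length \<pi>)"
      using Kv \<pi>(2) by (simp add: pot_def)
    have pot': "pot (q # qs) v = (card (boundary E (component E (W - Q) v)), dist (q # qs) v)"
      unfolding pot_def W' ..
    from prog[rule_format, OF vQ] show ?thesis
    proof (elim disjE conjE bexE exE)
      fix d y \<pi>' assume d: "d \<in> set cs" "{y, d} \<in> E" "path_in E (W - Q) y \<pi>' v" "length \<pi>' < length \<pi>"
        and le: "card (boundary E (component E (W - Q) v)) \<le> card (boundary E K)"
      have "(v, y) \<in> reach E (W - Q)" using path_in_reach[OF d(3)] by (rule reach_sym)
      then have "y \<in> component E (W - Q) v" by (simp add: component_def)
      \<comment> \<open>Vertices of the new cycle have the largest possible rank, so one adjacent to
        the component of \<open>v\<close> is automatically a newest hub there. This makes the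
        shorter way count for the new \<open>dist\<close>.\<close>
      moreover have "rank (q # qs) u' \<le> rank (q # qs) d" for u'
        using rank_le[of "q # qs" u'] d(1) by (simp add: q_def)
      ultimately have "newest (q # qs) (rest_component (q # qs) v) d"
        using d(1,2) unfolding newest_def W' by (auto simp: q_def)
      then have "dist (q # qs) v \<le> length \<pi>'"
        unfolding dist_def using d(2,3) W' by (intro Least_le) auto
      then show ?thesis using le d(4) unfolding pot pot' by auto
    qed (auto simp: pot pot')
  qed simp
  ultimately show ?thesis using that att by blast
qed

text \<open>The target is always the first uncovered vertex of an enumeration. Covered sets only
  grow, so the target is kept until it is covered, and an eternal target would make
  \<open>pot\<close> descend forever.\<close>

lemma process:
  obtains f where "f 0 = []" "\<forall>n. invariant (f n)"
    "\<forall>n. \<exists>q. f (Suc n) = q # f n \<and> attach (f n) q" "V = (\<Union>n. covered c (f n))"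
proof -
  define en where "en = from_nat_into V"
  have en: "range en = V"
    using inf countable_vertices unfolding en_def by (intro range_from_nat_into) auto
  define tgt where "tgt qs = (LEAST i. en i \<notin> covered c qs)" for qs
  have tgt: "en (tgt qs) \<in> V - covered c qs" for qs
  proof -
    have "infinite (V - covered c qs)" using inf by simp
    then obtain y where "y \<in> V" "y \<notin> covered c qs" by (metis DiffE ex_in_conv finite.emptyI)
    then have "\<exists>i. en i \<notin> covered c qs" using en by (metis imageE)
    then have "en (tgt qs) \<notin> covered c qs" unfolding tgt_def by (rule LeastI_ex)
    then show ?thesis using en by auto
  qed
  define R where "R = (less_than <*lex*> less_than :: ((nat \<times> nat) \<times> (nat \<times> nat)) set)"
  have wfR: "wf R" unfolding R_def by (intro wf_lex_prod wf_less_than)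
  have "\<exists>f. \<forall>n. (invariant (f n) \<and> (n = 0 \<longrightarrow> f n = [])) \<and>
     (\<exists>q. f (Suc n) = q # f n \<and> attach (f n) q \<and>
        (en (tgt (f n)) \<in> covered c (f (Suc n)) \<or>
         (pot (f (Suc n)) (en (tgt (f n))), pot (f n) (en (tgt (f n)))) \<in> R))"
  proof (rule dependent_nat_choice)
    show "\<exists>x. invariant x \<and> (0 = (0::nat) \<longrightarrow> x = [])"
      using c by (auto simp: invariant_def cross_def at_most_one_def)
    fix x and n :: nat assume "invariant x \<and> (n = 0 \<longrightarrow> x = [])"
    then show "\<exists>y. (invariant y \<and> (Suc n = 0 \<longrightarrow> y = [])) \<and> (\<exists>q. y = q # x \<and> attach x q \<and>
        (en (tgt x) \<in> covered c y \<or> (pot y (en (tgt x)), pot x (en (tgt x))) \<in> R))"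
      using advance[of x, OF _ tgt] unfolding R_def by (metis Zero_not_Suc)
  qed
  then obtain f where f: "\<And>n. invariant (f n)" "f 0 = []"
    and step: "\<And>n. \<exists>q. f (Suc n) = q # f n \<and> attach (f n) q \<and>
        (en (tgt (f n)) \<in> covered c (f (Suc n)) \<or>
         (pot (f (Suc n)) (en (tgt (f n))), pot (f n) (en (tgt (f n)))) \<in> R)"
    by metis
  have inc: "covered c (f m) \<subseteq> covered c (f n)" if "m \<le> n" for m n
    using that by (rule lift_Suc_mono_le[of "\<lambda>n. covered c (f n)", rotated]) (metis covered_mono step)
  have "\<exists>n. en i \<in> covered c (f n)" for i
  proof (rule ccontr)
    assume "\<nexists>n. en i \<in> covered c (f n)"
    then have ex: "\<exists>i. \<forall>n. en i \<notin> covered c (f n)" by blast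
    \<comment> \<open>The first vertex never covered: once all its predecessors are covered, it is
      the target at every later stage.\<close>
    define j where "j = (LEAST i. \<forall>n. en i \<notin> covered c (f n))"
    have j: "\<forall>n. en j \<notin> covered c (f n)" unfolding j_def using ex by (rule LeastI_ex)
    have "\<forall>i\<in>{..<j}. \<exists>n. en i \<in> covered c (f n)" using not_less_Least unfolding j_def by blast
    then obtain N where N: "\<And>i. i < j \<Longrightarrow> en i \<in> covered c (f (N i))" by (metis lessThan_iff)
    \<comment> \<open>The summand \<open>{0}\<close> keeps the maximum defined when \<open>j\<close>
      is 0.\<close>
    define M where "M = Max (N ` {..<j} \<union> {0})"
    have "en i \<in> covered c (f n)" if "i < j" "n \<ge> M" for i n
    proof -
      have "N i \<le> M" using that unfolding M_def by (intro Max_ge) auto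
      then show ?thesis using N[OF that(1)] inc[of "N i" n] that by auto
    qed
    then have tg: "tgt (f n) = j" if "n \<ge> M" for n
      using that j unfolding tgt_def by (intro Least_equality) (auto simp: not_less[symmetric])
    have "(pot (f (Suc n)) (en j), pot (f n) (en j)) \<in> R" if "n \<ge> M" for n
      using step[of n] tg[OF that] j by auto
    then have "\<exists>g. \<forall>n. (g (Suc n), g n) \<in> R"
      by (intro exI[of _ "\<lambda>n. pot (f (M + n)) (en j)"]) simp
    then show False using wfR unfolding wf_iff_no_infinite_down_chain by blast
  qed
  then have "V \<subseteq> (\<Union>n. covered c (f n))" using en by blast
  moreover have "(\<Union>n. covered c (f n)) \<subseteq> V" using f by (auto simp: invariant_def)
  ultimately show ?thesis using that[of f] f step by blast
qed

end

section \<open>The limit is a cactus\<close>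

lemma walk_iff_path_edges: "walk F xs \<longleftrightarrow> path_edges xs \<subseteq> F"
  by (auto simp: walk_def successively_conv_nth path_edges_def)

lemma path_edges_Cons: "path_edges (u # ps) = {{(u # ps) ! i, ps ! i} |i. i < length ps}"
  by (auto simp: path_edges_def)

lemma cycle_edges_Nil [simp]: "cycle_edges [] = {}"
  by (simp add: cycle_edges_def)

lemma path_edge_subset: "e \<in> path_edges xs \<Longrightarrow> e \<subseteq> set xs"
  by (auto simp: path_edges_def)

lemma cycle_edge_subset: "e \<in> cycle_edges xs \<Longrightarrow> e \<subseteq> set xs"
  by (auto simp: cycle_edges_def intro!: nth_mem mod_less_divisor)

lemma path_edges_subset_cycle_edges: "path_edges xs \<subseteq> cycle_edges xs"
proof
  fix e assume "e \<in> path_edges xs"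
  then obtain i where "Suc i < length xs" "e = {xs ! i, xs ! Suc i}" by (auto simp: path_edges_def)
  then show "e \<in> cycle_edges xs" unfolding cycle_edges_def by (auto intro!: exI[of _ i])
qed

lemma circuit_iff_cycle_edges:
  "circuit F xs \<longleftrightarrow> distinct xs \<and> length xs \<ge> 3 \<and> cycle_edges xs \<subseteq> F"
proof (cases "xs = []")
  case False
  have "cycle_edges xs = path_edges xs \<union> {{last xs, hd xs}}"
  proof (intro equalityI subsetI)
    fix e assume "e \<in> cycle_edges xs"
    then obtain i where i: "i < length xs" "e = {xs ! i, xs ! (Suc i mod length xs)}"
      by (auto simp: cycle_edges_def)
    show "e \<in> path_edges xs \<union> {{last xs, hd xs}}"
    proof (cases "Suc i < length xs")
      case True
      then show ?thesis using i by (auto simp: path_edges_def)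
    next
      case f: False
      then have "Suc i = length xs" using i by simp
      then have "i = length xs - 1" "Suc i mod length xs = 0" by simp_all
      then show ?thesis using i False by (simp add: last_conv_nth hd_conv_nth)
    qed
  next
    fix e assume "e \<in> path_edges xs \<union> {{last xs, hd xs}}"
    moreover have "{last xs, hd xs} \<in> cycle_edges xs"
      unfolding cycle_edges_def using False
      by (auto intro!: exI[of _ "length xs - 1"] simp: last_conv_nth hd_conv_nth)
    ultimately show "e \<in> cycle_edges xs" using path_edges_subset_cycle_edges by auto
  qed
  then show ?thesis by (auto simp: circuit_def walk_iff_path_edges)
qed (simp add: circuit_def)

lemma contr_rel_edge: "{x, y} \<in> F \<Longrightarrow> (g x, g y) \<in> contr_rel g F"
  by (auto simp: contr_rel_def)

lemma sym_contr_rel: "sym (contr_rel g F)"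
proof (rule symI)
  fix p q assume "(p, q) \<in> contr_rel g F"
  then obtain x y where "p = g x" "q = g y" "{y, x} \<in> F"
    by (auto simp: contr_rel_def insert_commute)
  then show "(q, p) \<in> contr_rel g F" by (auto simp: contr_rel_def)
qed

text \<open>Deleting the parent edge of \<open>b0\<close> cuts off the descendants of \<open>b0\<close>.\<close>

lemma mg_tree_of_parents:
  fixes g :: "'a \<Rightarrow> 'b"
  assumes D: "\<And>b a. (b, a) \<in> D \<Longrightarrow> b \<in> V"
    and r: "r \<in> V" "\<And>b a. (b, a) \<in> D \<Longrightarrow> g b \<noteq> g r"
    and uniq: "\<And>b a b' a'. (b, a) \<in> D \<Longrightarrow> (b', a') \<in> D \<Longrightarrow> g b = g b' \<Longrightarrow> b = b' \<and> a = a'"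
    and conn: "\<And>v. v \<in> V \<Longrightarrow> (g v, g r) \<in> (contr_rel g {{b, a} |b a. (b, a) \<in> D})\<^sup>*"
  shows "mg_tree g (g ` V) {{b, a} |b a. (b, a) \<in> D}"
proof -
  let ?F = "{{b, a} |b a. (b, a) \<in> D}"
  have sym: "(p, q) \<in> (contr_rel g ?F)\<^sup>* \<Longrightarrow> (q, p) \<in> (contr_rel g ?F)\<^sup>*" for p q
    by (meson sym_contr_rel sym_rtrancl symD)
  have "mg_connected (g ` V) (contr_rel g ?F)"
    unfolding mg_connected_def using r(1) conn sym by (blast intro: rtrancl_trans)
  moreover have "\<not> mg_connected (g ` V) (contr_rel g (?F - {e}))" if eF: "e \<in> ?F" for e
  proof
    obtain b0 a0 where e: "e = {b0, a0}" "(b0, a0) \<in> D" using eF by blast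
    define child where "child = {(g a, g b) |a b. (b, a) \<in> D}"
    define desc where "desc = child\<^sup>* `` {g b0}"
    assume "mg_connected (g ` V) (contr_rel g (?F - {e}))"
    then have "(g r, g b0) \<in> (contr_rel g (?F - {e}))\<^sup>*"
      using r(1) D[OF e(2)] by (auto simp: mg_connected_def)
    moreover have no_up: "p \<in> desc \<Longrightarrow> p = g b0 \<or> (\<exists>b a. (b, a) \<in> D \<and> p = g b \<and> g a \<in> desc)" for p
      unfolding desc_def child_def by (auto elim: rtranclE)
    \<comment> \<open>A walk from the root without \<open>e\<close> cannot enter
      \<open>desc\<close>. Going up it cannot, since \<open>desc\<close> is closed under children.
      Going down it would use the only parent edge of the class entered: this is the deleted
      \<open>e\<close> for the class of \<open>b0\<close>, and starts inside \<open>desc\<close> for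
      any other.\<close>
    have "q \<notin> desc" if "(g r, q) \<in> (contr_rel g (?F - {e}))\<^sup>*" for q
      using that
    proof (induction rule: rtrancl_induct)
      case base
      show ?case using no_up[of "g r"] r(2) e(2) by metis
    next
      case (step p q)
      then obtain x y where xy: "p = g x" "q = g y" "{x, y} \<in> ?F" "{x, y} \<noteq> e"
        by (auto simp: contr_rel_def)
      then obtain b a where ba: "(b, a) \<in> D" "{x, y} = {b, a}" by blast
      consider "x = b" "y = a" | "x = a" "y = b" using ba(2) by (auto simp: doubleton_eq_iff)
      then show ?case
      proof cases
        case 1
        have "(g a, g b) \<in> child" using ba(1) by (auto simp: child_def)
        then have "g a \<in> desc \<Longrightarrow> g b \<in> desc" unfolding desc_def by (auto intro: rtrancl_into_rtrancl)
        then show ?thesis using step.IH xy 1 by auto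
      next
        case 2
        show ?thesis
        proof
          assume "q \<in> desc"
          then consider "g b = g b0" | b' a' where "(b', a') \<in> D" "g b = g b'" "g a' \<in> desc"
            using no_up[of q] xy 2 by auto
          then show False
          proof cases
            case 1
            then have "b = b0" "a = a0" using uniq[OF ba(1) e(2)] by auto
            then show False using xy(4) ba(2) e by simp
          next
            case (2 b' a')
            then have "a = a'" using uniq[OF ba(1)] by blast
            then show False using step.IH xy \<open>x = a\<close> 2 by simp
          qed
        qed
      qed
    qed
    moreover have "g b0 \<in> desc" by (simp add: desc_def)
    ultimately show False by blast
  qed
  ultimately show ?thesis by (simp add: mg_tree_def)
qed

locale cactus_limit = cactus_process +
  fixes f :: "nat \<Rightarrow> 'a step list"
  assumes f0: "f 0 = []" and inv: "invariant (f n)"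
    and fSuc: "\<exists>q. f (Suc n) = q # f n \<and> attach (f n) q"
    and cover: "V = (\<Union>n. covered c (f n))"
begin

section \<open>The limit subgraph and its decomposition into cycles and paths\<close>

definition H :: "nat \<Rightarrow> 'a set" where "H n = covered c (f n)"
definition U :: "nat \<Rightarrow> 'a set" where "U n = hubs c (f n)"
definition anchor :: "nat \<Rightarrow> 'a" where "anchor n = fst (hd (f (Suc n)))"
definition ps :: "nat \<Rightarrow> 'a list" where "ps n = fst (snd (hd (f (Suc n))))"
definition cs :: "nat \<Rightarrow> 'a list" where "cs n = snd (snd (hd (f (Suc n))))"
text \<open>Step \<open>n\<close> leads from \<open>H n\<close> to \<open>H (Suc n)\<close> by
  adding \<open>Q n\<close>, whose vertices get rank \<open>Suc n\<close>; rank 0 is reserved for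
  the initial cycle.\<close>

definition Q :: "nat \<Rightarrow> 'a set" where "Q n = set (ps n) \<union> set (cs n)"

definition EF :: "'a set set" where
  "EF = cycle_edges c \<union> (\<Union>n. cycle_edges (cs n)) \<union> (\<Union>n. path_edges (anchor n # ps n))"

lemma f_Suc: "f (Suc n) = (anchor n, ps n, cs n) # f n"
  and attach_n: "attach (f n) (anchor n, ps n, cs n)"
  using fSuc[of n] unfolding anchor_def ps_def cs_def by auto

lemma H_0: "H 0 = set c" and U_0: "U 0 = set c"
  by (simp_all add: H_def U_def f0)

lemma H_Suc: "H (Suc n) = Q n \<union> H n" and U_Suc: "U (Suc n) = set (cs n) \<union> U n"
  by (auto simp: H_def U_def f_Suc Q_def)

lemma U_subset_H: "U n \<subseteq> H n"
  by (simp add: H_def U_def hubs_subset_covered)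

lemma ps_facts: "distinct (ps n)" "ps n \<noteq> []" "walk E (ps n)" "{hd (ps n), anchor n} \<in> E"
  and cs_facts: "cs n = [] \<or> circuit E (cs n) \<and> set (ps n) \<inter> set (cs n) = {last (ps n)}"
  and Q_facts: "Q n \<subseteq> V - H n"
  and newest_anchor: "newest (f n) (rest_component (f n) (hd (ps n))) (anchor n)"
  using attach_n[of n] by (auto simp: Q_def H_def)

lemma anchor_in_U: "anchor n \<in> U n"
  using newest_anchor[of n] by (simp add: newest_def U_def)

lemma H_mono: "m \<le> n \<Longrightarrow> H m \<subseteq> H n"
  by (rule lift_Suc_mono_le) (auto simp: H_Suc)

lemma Q_subset_H: "n < m \<Longrightarrow> Q n \<subseteq> H m"
  using H_mono[of "Suc n" m] by (auto simp: H_Suc)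

lemma finite_H: "finite (H n)"
  by (simp add: H_def)

lemma H_subset_V: "H n \<subseteq> V"
  using inv[of n] by (simp add: H_def invariant_def)

lemma union_H: "(\<Union>n. H n) = V"
  using cover by (simp add: H_def)

lemma Q_disjoint: "n \<noteq> m \<Longrightarrow> Q n \<inter> Q m = {}"
proof (induction n m rule: linorder_wlog)
  case (le a b)
  then show ?case using Q_subset_H[of a b] Q_facts[of b] by auto
qed auto

lemma Q_nonempty: "hd (ps n) \<in> Q n"
  using ps_facts(2) by (simp add: Q_def)

lemma cover_cases:
  assumes "y \<in> V"
  obtains "y \<in> set c" | n where "y \<in> Q n"
proof -
  obtain n where "y \<in> H n" using assms union_H by auto
  then have "y \<in> set c \<or> (\<exists>n. y \<in> Q n)" by (induction n) (auto simp: H_0 H_Suc)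
  then show ?thesis using that by blast
qed

lemma hub_circuit:
  assumes "y \<in> U n"
  obtains xs where "y \<in> set xs" "circuit E xs" "xs = c \<or> (\<exists>m<n. xs = cs m)"
proof -
  have "\<exists>xs. y \<in> set xs \<and> circuit E xs \<and> (xs = c \<or> (\<exists>m<n. xs = cs m))"
    using assms
  proof (induction n)
    case (Suc n)
    then consider "y \<in> set (cs n)" | "y \<in> U n" by (auto simp: U_Suc)
    then show ?case
    proof cases
      case 1
      then show ?thesis using cs_facts[of n] by (intro exI[of _ "cs n"]) auto
    next
      case 2
      then show ?thesis using Suc.IH less_Suc_eq by metis
    qed
  qed (use c in \<open>auto simp: U_0\<close>)
  then show ?thesis using that by blast
qed

lemma EF_subset: "EF \<subseteq> E"
proof -
  have "cycle_edges (cs n) \<subseteq> E" for n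
    using cs_facts[of n] by (auto simp: circuit_iff_cycle_edges cycle_edges_def)
  moreover have "walk E (anchor n # ps n)" for n
    using ps_facts[of n] by (simp add: walk_Cons insert_commute)
  moreover have "cycle_edges c \<subseteq> E" using c by (simp add: circuit_iff_cycle_edges)
  ultimately show ?thesis by (auto simp: EF_def walk_iff_path_edges)
qed

definition cycles :: "('a set \<times> 'a set set) set" where
  "cycles = insert (set c, cycle_edges c) {(set (cs n), cycle_edges (cs n)) |n. cs n \<noteq> []}"

definition paths :: "('a set \<times> 'a set set) set" where
  "paths = {(set (anchor n # ps n), path_edges (anchor n # ps n)) |n. True}"

text \<open>Position \<open>i\<close> of \<open>ps n\<close> is position \<open>Suc i\<close> of
  \<open>anchor n # ps n\<close>, so the second component is the predecessor on the path. After
  contraction a new cycle has its only parent edge at \<open>last (ps n)\<close>.\<close>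

definition parent :: "('a \<times> 'a) set" where
  "parent = {(ps n ! i, (anchor n # ps n) ! i) |n i. i < length (ps n)}"

lemma parentI: "i < length (ps n) \<Longrightarrow> (ps n ! i, (anchor n # ps n) ! i) \<in> parent"
  unfolding parent_def by blast

lemma c_disjoint: "set c \<inter> Q n = {}"
  using H_mono[of 0 n] Q_facts[of n] by (auto simp: H_0)

lemma class_c: "y \<in> set c \<Longrightarrow> contr_class cycles y = set c"
  using c_disjoint by (auto simp: contr_class_def cycles_def Q_def)

lemma class_cs:
  assumes "y \<in> set (cs n)"
  shows "contr_class cycles y = set (cs n)"
proof -
  have "y \<notin> set c" using assms c_disjoint[of n] by (auto simp: Q_def)
  moreover have "m = n" if "y \<in> set (cs m)" for m
    using that assms Q_disjoint[of m n] by (auto simp: Q_def)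
  ultimately have "\<forall>d\<in>cycles. y \<in> fst d \<longrightarrow> fst d = set (cs n)"
    by (auto simp: cycles_def)
  moreover have "\<exists>d\<in>cycles. fst d = set (cs n)" using assms by (force simp: cycles_def)
  ultimately show ?thesis using assms unfolding contr_class_def by auto
qed

lemma class_other:
  assumes "y \<in> Q n" "y \<notin> set (cs n)"
  shows "contr_class cycles y = {y}"
proof -
  have "y \<notin> set c" using assms c_disjoint[of n] by auto
  moreover have "y \<notin> set (cs m)" for m
    using assms Q_disjoint[of m n] by (cases "m = n") (auto simp: Q_def)
  ultimately show ?thesis by (auto simp: contr_class_def cycles_def)
qed

lemma class_subset: "y \<in> Q n \<Longrightarrow> contr_class cycles y \<subseteq> Q n"
  using class_cs[of y n] class_other[of y n] by (cases "y \<in> set (cs n)") (auto simp: Q_def)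

lemma class_self: "y \<in> contr_class cycles y"
  by (simp add: contr_class_def)

text \<open>The later end of such an edge lies in \<open>Q n\<close>, so the only candidate cycle is
  \<open>cs n\<close>. That cycle meets \<open>ps n\<close> only in its last vertex and avoids the
  anchor, which is older. Hence removing the cycle edges from \<open>EF\<close> leaves exactly the
  path edges.\<close>

lemma path_edge_not_cycle_edge:
  assumes "e \<in> path_edges (anchor n # ps n)" "xs = c \<or> (\<exists>m. xs = cs m)"
  shows "e \<notin> cycle_edges xs"
proof
  assume "e \<in> cycle_edges xs"
  then have sub: "e \<subseteq> set xs" by (rule cycle_edge_subset)
  obtain i where i: "i < length (ps n)" "e = {(anchor n # ps n) ! i, ps n ! i}"
    using assms(1) by (auto simp: path_edges_Cons)
  have b: "ps n ! i \<in> set (ps n)" "ps n ! i \<in> set xs" using i sub by auto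
  then have "xs \<noteq> c" using c_disjoint[of n] by (auto simp: Q_def)
  then obtain m where m: "xs = cs m" using assms(2) by blast
  then have "m = n" using b Q_disjoint[of m n] by (auto simp: Q_def)
  then have xs: "xs = cs n" using m by simp
  then have int: "set (ps n) \<inter> set xs = {last (ps n)}" using b cs_facts[of n] by auto
  then have last: "ps n ! i = last (ps n)" using b by auto
  show False
  proof (cases i)
    case 0
    then have "anchor n \<in> Q n" using i(2) sub xs by (auto simp: Q_def)
    then show False using anchor_in_U[of n] U_subset_H[of n] Q_facts[of n] by auto
  next
    case (Suc j)
    then have "ps n ! j \<in> set (ps n) \<inter> set xs" using i sub by auto
    then have "ps n ! j = ps n ! i" using int last by auto
    then show False using Suc i(1) ps_facts(1)[of n] by (simp add: nth_eq_iff_index_eq)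
  qed
qed

lemma union_cycles:
  "(\<Union>d\<in>cycles. fst d) = set c \<union> (\<Union>n. set (cs n))"
  "(\<Union>d\<in>cycles. snd d) = cycle_edges c \<union> (\<Union>n. cycle_edges (cs n))"
proof -
  have C: "cycles = insert (set c, cycle_edges c)
      ((\<lambda>n. (set (cs n), cycle_edges (cs n))) ` {n. cs n \<noteq> []})"
    by (auto simp: cycles_def)
  have "cycle_edges (cs n) \<subseteq> (\<Union>n\<in>{n. cs n \<noteq> []}. cycle_edges (cs n))"
    and "set (cs n) \<subseteq> (\<Union>n\<in>{n. cs n \<noteq> []}. set (cs n))" for n
    by (cases "cs n = []"; auto)+
  then have "(\<Union>n\<in>{n. cs n \<noteq> []}. cycle_edges (cs n)) = (\<Union>n. cycle_edges (cs n))"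
    "(\<Union>n\<in>{n. cs n \<noteq> []}. set (cs n)) = (\<Union>n. set (cs n))" by blast+
  then show "(\<Union>d\<in>cycles. fst d) = set c \<union> (\<Union>n. set (cs n))"
    "(\<Union>d\<in>cycles. snd d) = cycle_edges c \<union> (\<Union>n. cycle_edges (cs n))"
    unfolding C by simp_all
qed

lemma tree_edges: "EF - (\<Union>d\<in>cycles. snd d) = {{b, a} |b a. (b, a) \<in> parent}"
proof -
  have "EF - (\<Union>d\<in>cycles. snd d) = (\<Union>n. path_edges (anchor n # ps n))"
    using path_edge_not_cycle_edge unfolding EF_def union_cycles by blast
  also have "\<dots> = {{b, a} |b a. (b, a) \<in> parent}"
    by (auto simp: path_edges_Cons parent_def insert_commute)
  finally show ?thesis .
qed

lemma classes_tree:
  "mg_tree (contr_class cycles) (contr_class cycles ` V) (EF - (\<Union>d\<in>cycles. snd d))"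
  unfolding tree_edges
proof (rule mg_tree_of_parents)
  let ?R = "contr_rel (contr_class cycles) {{b, a} |b a. (b, a) \<in> parent}"
  let ?r = "hd c"
  have r: "?r \<in> set c" using c by (cases c) (auto simp: circuit_def)
  then show "?r \<in> V" using c by auto
  have pQ: "\<exists>n i. i < length (ps n) \<and> b = ps n ! i \<and> a = (anchor n # ps n) ! i \<and> b \<in> Q n"
    if ba: "(b, a) \<in> parent" for b a
  proof -
    obtain n i where "i < length (ps n)" "b = ps n ! i" "a = (anchor n # ps n) ! i"
      using ba unfolding parent_def by blast
    then show ?thesis by (intro exI[of _ n] exI[of _ i]) (simp add: Q_def)
  qed
  then show "b \<in> V" if "(b, a) \<in> parent" for b a
    using that Q_facts by blast
  show "contr_class cycles b \<noteq> contr_class cycles ?r" if "(b, a) \<in> parent" for b a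
    using pQ[OF that] class_self[of b] class_c[OF r] c_disjoint by blast
  show "b = b' \<and> a = a'"
    if ba: "(b, a) \<in> parent" and ba': "(b', a') \<in> parent"
      and eq: "contr_class cycles b = contr_class cycles b'" for b a b' a'
  proof -
    obtain n i where n: "i < length (ps n)" "b = ps n ! i" "a = (anchor n # ps n) ! i" "b \<in> Q n"
      using pQ[OF ba] by blast
    obtain m j where m: "j < length (ps m)" "b' = ps m ! j" "a' = (anchor m # ps m) ! j" "b' \<in> Q m"
      using pQ[OF ba'] by blast
    have "b' \<in> Q n" using class_self[of b'] class_subset[OF n(4)] eq by auto
    then have mn: "m = n" using m(4) Q_disjoint[of m n] by auto
    have bp: "b \<in> set (ps n)" "b' \<in> set (ps n)" using n m mn by auto
    \<comment> \<open>A class inside \<open>Q n\<close> contains at most one vertex of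
      \<open>ps n\<close>: it is a singleton or \<open>set (cs n)\<close>.\<close>
    have "b = b'"
    proof (cases "b \<in> set (cs n)")
      case True
      then have "b' \<in> set (cs n)" using class_self[of b'] class_cs[OF True] eq by simp
      then have "b \<in> set (ps n) \<inter> set (cs n)" "b' \<in> set (ps n) \<inter> set (cs n)"
        using True bp by auto
      moreover have "set (ps n) \<inter> set (cs n) = {last (ps n)}" using True cs_facts[of n] by auto
      ultimately show ?thesis by simp
    next
      case False
      then show ?thesis using class_self[of b'] class_other[OF n(4) False] eq by simp
    qed
    then show ?thesis using n m mn ps_facts(1)[of n] by (simp add: nth_eq_iff_index_eq)
  qed
  have up: "(contr_class cycles b, contr_class cycles ?r) \<in> ?R\<^sup>*"
    if "(b, a) \<in> parent" "(contr_class cycles a, contr_class cycles ?r) \<in> ?R\<^sup>*" for b a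
  proof -
    have "{b, a} \<in> {{b, a} |b a. (b, a) \<in> parent}" using that(1) by blast
    then have "(contr_class cycles b, contr_class cycles a) \<in> ?R" by (rule contr_rel_edge)
    then show ?thesis using that(2) by (rule converse_rtrancl_into_rtrancl)
  qed
  have "(contr_class cycles v, contr_class cycles ?r) \<in> ?R\<^sup>*" if "v \<in> H n" for v n
    using that
  proof (induction n arbitrary: v)
    case 0
    then show ?case using class_c[OF r] class_c[of v] by (simp add: H_0)
  next
    case (Suc n)
    have pi: "(contr_class cycles (ps n ! i), contr_class cycles ?r) \<in> ?R\<^sup>*" if "i < length (ps n)" for i
      using that
    proof (induction i)
      case 0
      have "(ps n ! 0, anchor n) \<in> parent" using 0 parentI[of 0 n] by simp
      then show ?case by (rule up) (use Suc.IH anchor_in_U U_subset_H in auto)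
    next
      case (Suc i)
      have "(ps n ! Suc i, ps n ! i) \<in> parent" using Suc.prems parentI[of "Suc i" n] by simp
      then show ?case by (rule up) (use Suc in auto)
    qed
    then have pv: "(contr_class cycles p, contr_class cycles ?r) \<in> ?R\<^sup>*" if p: "p \<in> set (ps n)" for p
    proof -
      obtain i where i: "i < length (ps n)" "ps n ! i = p" using p unfolding in_set_conv_nth by blast
      show ?thesis using pi[OF i(1)] unfolding i(2) .
    qed
    consider "v \<in> H n" | "v \<in> set (ps n)" | "v \<in> set (cs n)"
      using Suc.prems by (auto simp: H_Suc Q_def)
    then show ?case
    proof cases
      case 1
      then show ?thesis by (rule Suc.IH)
    next
      case 2
      then show ?thesis by (rule pv)
    next
      case 3
      then have "set (ps n) \<inter> set (cs n) = {last (ps n)}" using cs_facts[of n] by auto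
      then have l: "last (ps n) \<in> set (ps n)" "last (ps n) \<in> set (cs n)" by auto
      show ?thesis using pv[OF l(1)] unfolding class_cs[OF l(2)] class_cs[OF 3] .
    qed
  qed
  then show "(contr_class cycles v, contr_class cycles ?r) \<in> ?R\<^sup>*" if "v \<in> V" for v
    using that union_H by auto
qed

text \<open>A vertex on two of the paths would be an anchor, hence on a cycle as well, and have degree 4.\<close>

lemma paths_disjoint: "n < m \<Longrightarrow> set (anchor n # ps n) \<inter> set (anchor m # ps m) = {}"
proof (rule ccontr)
  assume nm: "n < m" and "set (anchor n # ps n) \<inter> set (anchor m # ps m) \<noteq> {}"
  then obtain y where y: "y \<in> set (anchor n # ps n)" "y \<in> set (anchor m # ps m)" by blast
  have PH: "set (anchor n # ps n) \<subseteq> H m"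
    using anchor_in_U[of n] U_subset_H[of n] H_mono[of n m] Q_subset_H[OF nm] nm by (auto simp: Q_def)
  then have "y \<notin> set (ps m)" using y(1) Q_facts[of m] by (auto simp: Q_def)
  then have ym: "y = anchor m" using y(2) by auto
  then obtain xs where xs: "y \<in> set xs" "circuit E xs" "xs = c \<or> (\<exists>k<m. xs = cs k)"
    using hub_circuit[of y m] anchor_in_U[of m] by metis
  then have xs': "xs = c \<or> (\<exists>k. xs = cs k)" by blast
  have "circuit (cycle_edges xs) xs" using xs(2) by (simp add: circuit_iff_cycle_edges)
  then obtain a b where ab: "a \<noteq> b" "a \<noteq> y" "b \<noteq> y" "{y, a} \<in> cycle_edges xs" "{y, b} \<in> cycle_edges xs"
    by (rule circuit_neighbours[OF _ xs(1)])
  have "\<exists>e\<in>path_edges (anchor n # ps n). y \<in> e"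
  proof (cases "y = anchor n")
    case True
    then show ?thesis using ps_facts(2)[of n] by (auto simp: path_edges_Cons intro!: exI[of _ "{y, ps n ! 0}"] exI[of _ 0])
  next
    case False
    then obtain i where "i < length (ps n)" "y = ps n ! i" using y(1) by (auto simp: in_set_conv_nth)
    then show ?thesis by (auto simp: path_edges_Cons)
  qed
  then obtain e where e: "e \<in> path_edges (anchor n # ps n)" "y \<in> e" by blast
  have "{(anchor m # ps m) ! 0, ps m ! 0} \<in> path_edges (anchor m # ps m)"
    using ps_facts(2)[of m] unfolding path_edges_Cons by blast
  then have e': "{y, hd (ps m)} \<in> path_edges (anchor m # ps m)"
    using ym ps_facts(2)[of m] by (simp add: hd_conv_nth)
  \<comment> \<open>The first vertex of the later path is new at step \<open>m\<close>, whereas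
    \<open>e\<close> lies in \<open>H m\<close>.\<close>
  have ne: "hd (ps m) \<notin> e"
    using path_edge_subset[OF e(1)] PH Q_nonempty[of m] Q_facts[of m] by blast
  have nc: "e \<notin> cycle_edges xs" "{y, hd (ps m)} \<notin> cycle_edges xs"
    using path_edge_not_cycle_edge[OF e(1) xs'] path_edge_not_cycle_edge[OF e' xs'] by auto
  show False
  proof (rule four_edges[of "{y, a}" "{y, b}" e "{y, hd (ps m)}" y])
    have "cycle_edges xs \<subseteq> E" using xs(2) by (simp add: circuit_iff_cycle_edges)
    moreover have "e \<in> EF" "{y, hd (ps m)} \<in> EF" using e e' by (auto simp: EF_def)
    ultimately show "{{y, a}, {y, b}, e, {y, hd (ps m)}} \<subseteq> E" using ab EF_subset by auto
    show "distinct [{y, a}, {y, b}, e, {y, hd (ps m)}]"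
      using ab nc ne by (auto simp: doubleton_eq_iff)
  qed (use e in auto)
qed

lemma EF_cactus: "cactus V EF"
  unfolding cactus_def
proof (rule conjI[OF _ conjI[OF _ exI[of _ cycles, OF exI[of _ paths]]]]; (intro conjI)?)
  show "graph V EF" using graph EF_subset by (auto simp: graph_def)
  show "subcubic V EF"
    unfolding subcubic_def
  proof
    fix v assume "v \<in> V"
    then have "finite {e \<in> E. v \<in> e}" "card {e \<in> E. v \<in> e} \<le> 3" using sub by (auto simp: subcubic_def)
    moreover have "{e \<in> EF. v \<in> e} \<subseteq> {e \<in> E. v \<in> e}" using EF_subset by auto
    ultimately show "finite {e \<in> EF. v \<in> e} \<and> card {e \<in> EF. v \<in> e} \<le> 3"
      by (meson card_mono finite_subset le_trans)
  qed
  show "\<forall>d\<in>cycles. is_cycle d"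
    using c cs_facts by (fastforce simp: cycles_def is_cycle_def circuit_def)
  have dist: "distinct (anchor n # ps n)" for n
    using ps_facts(1)[of n] anchor_in_U[of n] U_subset_H[of n] Q_facts[of n] by (auto simp: Q_def)
  show "\<forall>p\<in>paths. is_path p"
  proof
    fix p assume "p \<in> paths"
    then obtain n where "p = (set (anchor n # ps n), path_edges (anchor n # ps n))"
      unfolding paths_def by blast
    then show "is_path p"
      unfolding is_path_def using dist[of n] by (intro exI[of _ "anchor n # ps n"]) simp
  qed
  show "\<forall>d\<in>cycles. \<forall>d'\<in>cycles. d \<noteq> d' \<longrightarrow> fst d \<inter> fst d' = {}"
  proof (intro ballI impI)
    fix d d' assume d: "d \<in> cycles" "d' \<in> cycles" "d \<noteq> d'"
    have cc: "set (cs n) \<inter> set (cs m) = {}" if "n \<noteq> m" for n m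
      using Q_disjoint[OF that] by (auto simp: Q_def)
    have c0: "set c \<inter> set (cs n) = {}" for n using c_disjoint[of n] by (auto simp: Q_def)
    have "x = (set c, cycle_edges c) \<or> (\<exists>n. x = (set (cs n), cycle_edges (cs n)))"
      if "x \<in> cycles" for x
      using that by (auto simp: cycles_def)
    from this[OF d(1)] this[OF d(2)] show "fst d \<inter> fst d' = {}"
    proof (elim disjE exE)
      fix n m assume nm: "d = (set (cs n), cycle_edges (cs n))" "d' = (set (cs m), cycle_edges (cs m))"
      then have "n \<noteq> m" using d(3) by auto
      then show ?thesis using cc nm by simp
    qed (use d(3) c0 in auto)
  qed
  show "\<forall>p\<in>paths. \<forall>p'\<in>paths. p \<noteq> p' \<longrightarrow> fst p \<inter> fst p' = {}"
  proof (intro ballI impI)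
    fix p p' assume "p \<in> paths" "p' \<in> paths" "p \<noteq> p'"
    then obtain n m where nm: "p = (set (anchor n # ps n), path_edges (anchor n # ps n))"
      "p' = (set (anchor m # ps m), path_edges (anchor m # ps m))" "n \<noteq> m"
      unfolding paths_def by blast
    then show "fst p \<inter> fst p' = {}"
      using paths_disjoint[of n m] paths_disjoint[of m n] by (cases "n < m") auto
  qed
  have "(\<Union>p\<in>paths. fst p) = (\<Union>n. set (anchor n # ps n))" by (auto simp: paths_def)
  moreover have "V = set c \<union> (\<Union>n. Q n)"
    using c(2) Q_facts by (auto elim: cover_cases)
  moreover have "anchor n \<in> V" for n
    using anchor_in_U U_subset_H H_subset_V by blast
  ultimately show "V = (\<Union>d\<in>cycles. fst d) \<union> (\<Union>p\<in>paths. fst p)"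
    unfolding union_cycles by (auto simp: Q_def)
  show "EF = (\<Union>d\<in>cycles. snd d) \<union> (\<Union>p\<in>paths. snd p)"
    unfolding union_cycles by (auto simp: EF_def paths_def)
  show "mg_tree (contr_class cycles) (contr_class cycles ` V) (EF - (\<Union>d\<in>cycles. snd d))"
    by (rule classes_tree)
qed

end

section \<open>Faithfulness\<close>

text \<open>Koenig's lemma. The state of the choice is a pair: the visited set \<open>A\<close> and
  a current vertex \<open>v\<close> whose component in \<open>X - A\<close> is infinite.\<close>

lemma konig_ray:
  assumes inf: "infinite X" and b: "b \<in> X" "\<forall>y\<in>X. (b, y) \<in> reach F X"
    and fin: "\<And>y. finite {z. {y, z} \<in> F}"
  obtains s :: "nat \<Rightarrow> 'a" where "inj s" "\<forall>n. s n \<in> X" "\<forall>n. {s n, s (Suc n)} \<in> F"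
proof -
  define ok where "ok A v \<longleftrightarrow> v \<in> X - A \<and> infinite (component F (X - A) v)" for A v
  have "X \<subseteq> component F X b" using b by (auto simp: component_def)
  then have "infinite (component F X b)" using inf finite_subset by blast
  then have "ok {} b" using b by (simp add: ok_def)
  have next_ok: "\<exists>v'. ok (insert v A) v' \<and> {v, v'} \<in> F" if ok: "ok A v" for A v
  proof -
    let ?N = "{v'. {v, v'} \<in> F \<and> v' \<in> X - insert v A}"
    \<comment> \<open>After removal of \<open>v\<close>, its component falls into the components of
      its finitely many unvisited neighbours, so one of these is infinite.\<close>
    have "component F (X - A) v \<subseteq> insert v (\<Union>v'\<in>?N. component F (X - insert v A) v')"
    proof
      fix y assume "y \<in> component F (X - A) v"
      then have "(v, y) \<in> reach F (X - A)" by (simp add: component_def)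
      then show "y \<in> insert v (\<Union>v'\<in>?N. component F (X - insert v A) v')"
      proof (induction rule: reach_induct)
        case (step y z)
        show ?case
        proof (cases "z = v \<or> y = v")
          case True
          then show ?thesis using step component_self[of z] by auto
        next
          case False
          then obtain v' where v': "v' \<in> ?N" "y \<in> component F (X - insert v A) v'"
            using step by auto
          have "z \<in> component F (X - insert v A) v'"
            by (rule component_edge[OF v'(2)]) (use v'(1) False step in auto)
          then show ?thesis using v'(1) by blast
        qed
      qed simp
    qed
    moreover have "finite ?N" using fin[of v] by (rule rev_finite_subset) auto
    ultimately obtain v' where "v' \<in> ?N" "infinite (component F (X - insert v A) v')"
      using ok finite_subset unfolding ok_def by (metis (no_types, lifting) finite_UN_I finite_insert)
    then show ?thesis by (auto simp: ok_def)
  qed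
  have "\<exists>g. \<forall>n. ok (fst (g n)) (snd (g n)) \<and>
      (fst (g (Suc n)) = insert (snd (g n)) (fst (g n)) \<and> {snd (g n), snd (g (Suc n))} \<in> F)"
  proof (rule dependent_nat_choice)
    show "\<exists>x. ok (fst x) (snd x)" using \<open>ok {} b\<close> by (intro exI[of _ "({}, b)"]) simp
    fix x and n :: nat assume "ok (fst x) (snd x)"
    from next_ok[OF this] obtain v' where "ok (insert (snd x) (fst x)) v'" "{snd x, v'} \<in> F" by blast
    then show "\<exists>y. ok (fst y) (snd y) \<and> (fst y = insert (snd x) (fst x) \<and> {snd x, snd y} \<in> F)"
      by (intro exI[of _ "(insert (snd x) (fst x), v')"]) simp
  qed
  then obtain g where g: "\<And>n. ok (fst (g n)) (snd (g n))"
    "\<And>n. fst (g (Suc n)) = insert (snd (g n)) (fst (g n))"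
    "\<And>n. {snd (g n), snd (g (Suc n))} \<in> F"
    by blast
  have visited: "m < n \<Longrightarrow> snd (g m) \<in> fst (g n)" for m n
    by (induction n) (auto simp: g(2) less_Suc_eq)
  have "snd (g m) \<noteq> snd (g n)" if "m < n" for m n
    using visited[OF that] g(1)[of n] by (auto simp: ok_def)
  then have "inj (\<lambda>n. snd (g n))" by (intro linorder_injI) auto
  moreover have "snd (g n) \<in> X" for n using g(1)[of n] by (simp add: ok_def)
  ultimately show ?thesis using that[of "\<lambda>n. snd (g n)"] g(3) by blast
qed

lemma inj_leaves:
  fixes r :: "nat \<Rightarrow> 'a"
  assumes "inj r" "finite S"
  obtains k where "\<And>m. m \<ge> k \<Longrightarrow> r m \<notin> S"
proof -
  have "finite (r -` S)" using assms by (simp add: finite_vimageI)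
  then obtain k where "\<forall>m\<in>r -` S. m < k" using finite_nat_set_iff_bounded by metis
  then show ?thesis using that[of k] by (metis leD vimageI)
qed

lemma tail_reach:
  assumes "\<And>n. {r n, r (Suc n)} \<in> F" "\<And>n. n \<ge> k \<Longrightarrow> r n \<in> W" "k \<le> a" "k \<le> b"
  shows "(r a, r b) \<in> reach F W"
proof -
  have *: "(r k, r (k + n)) \<in> reach F W" for n
  proof (induction n)
    case (Suc n)
    have "(r (k + n), r (k + Suc n)) \<in> reach F W"
      using assms(1)[of "k + n"] assms(2) by (intro reach_edge) auto
    then show ?case using Suc by (rule reach_trans[rotated])
  qed simp
  have "(r k, r a) \<in> reach F W" "(r k, r b) \<in> reach F W"
    using *[of "a - k"] *[of "b - k"] assms(3,4) by simp_all
  then show ?thesis by (blast intro: reach_sym reach_trans)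
qed

lemma rays_equiv_reach:
  "rays_equiv V F r s \<longleftrightarrow> (\<forall>S. finite S \<and> S \<subseteq> V \<longrightarrow>
     (\<exists>k. \<forall>m\<ge>k. \<forall>n\<ge>k. r m \<notin> S \<and> s n \<notin> S \<and> (r m, s n) \<in> reach F (V - S)))"
proof -
  have "- (V - S) = S \<union> - V" for S by auto
  then show ?thesis by (simp add: rays_equiv_def reach_def)
qed

context cactus_limit
begin

section \<open>Stability of ranks and hubs, and connectedness of the steps near an end\<close>

lemma length_f [simp]: "length (f n) = n"
  by (induction n) (auto simp: f0 f_Suc)

lemma rank_stable:
  assumes "y \<in> H n" "n \<le> m"
  shows "rank (f m) y = rank (f n) y"
  using assms(2)
proof (induction m rule: dec_induct)
  case (step m)
  have "y \<notin> Q m" using assms(1) H_mono[OF step(1)] Q_facts[of m] by auto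
  then show ?case using step by (simp add: f_Suc Q_def)
qed simp

lemma rank_Q:
  assumes "y \<in> Q k" "k < m"
  shows "rank (f m) y = Suc k"
proof -
  have "rank (f (Suc k)) y = Suc k" using assms(1) by (simp add: f_Suc Q_def)
  moreover have "y \<in> H (Suc k)" using assms(1) by (simp add: H_Suc)
  ultimately show ?thesis using rank_stable[of y "Suc k" m] assms(2) by simp
qed

lemma rank_c: "y \<in> set c \<Longrightarrow> rank (f m) y = 0"
  using rank_stable[of y 0 m] by (simp add: H_0 f0)

lemma H_stages:
  assumes "y \<in> H m" "y \<notin> H n"
  obtains k where "n \<le> k" "k < m" "y \<in> Q k"
proof -
  have "\<exists>k. k < m \<and> y \<in> Q k \<or> y \<in> H 0"
    using assms(1) by (induction m) (auto simp: H_Suc less_Suc_eq)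
  moreover have "y \<notin> H 0" using assms(2) H_mono[of 0 n] by auto
  ultimately obtain k where k: "k < m" "y \<in> Q k" by blast
  then have "n \<le> k" using assms(2) Q_subset_H[of k n] by (meson not_le subsetD)
  then show ?thesis using that k by blast
qed

text \<open>Whether a vertex is a hub is settled when it is covered, because later steps add only
  uncovered vertices.\<close>

lemma U_stable: "i \<le> j \<Longrightarrow> y \<in> U j \<Longrightarrow> y \<in> H i \<Longrightarrow> y \<in> U i"
proof (induction j rule: dec_induct)
  case (step j)
  have "y \<notin> Q j" using step H_mono[of i j] Q_facts[of j] by auto
  then show ?case using step by (auto simp: U_Suc Q_def)
qed

lemma Q_connected:
  assumes "a \<in> Q n" "b \<in> Q n"
  shows "(a, b) \<in> reach EF (Q n)"
proof -
  have "walk EF (anchor n # ps n)" by (auto simp: walk_iff_path_edges EF_def)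
  then have p: "walk EF (ps n)" by (simp add: walk_Cons)
  have "cycle_edges (cs n) \<subseteq> EF" by (auto simp: EF_def)
  then have c: "walk EF (cs n)"
    using path_edges_subset_cycle_edges by (fastforce simp: walk_iff_path_edges)
  have l: "last (ps n) \<in> set (ps n)" using ps_facts(2) by simp
  have "(last (ps n), y) \<in> reach EF (Q n)" if "y \<in> Q n" for y
  proof (cases "y \<in> set (ps n)")
    case True
    then show ?thesis using p l by (intro walk_reach[of _ "ps n"]) (auto simp: Q_def)
  next
    case False
    then have y: "y \<in> set (cs n)" using that by (simp add: Q_def)
    then have "last (ps n) \<in> set (cs n)" using cs_facts[of n] by auto
    then show ?thesis using c y by (intro walk_reach[of _ "cs n"]) (auto simp: Q_def)
  qed
  then show ?thesis using assms by (blast intro: reach_sym reach_trans)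
qed

lemma Q_component:
  assumes "a \<in> Q n" "a \<in> component E (V - H n) z"
  shows "Q n \<subseteq> component E (V - H n) z"
proof
  fix y assume "y \<in> Q n"
  then have "(a, y) \<in> reach E (V - H n)"
    using Q_connected[OF assms(1)] EF_subset Q_facts[of n] by (blast intro: reach_mono)
  then have "y \<in> component E (V - H n) a" by (simp add: component_def)
  then show "y \<in> component E (V - H n) z" using component_eq[OF assms(2)] by simp
qed

lemma finite_subset_H:
  assumes "finite S" "S \<subseteq> V"
  obtains n where "S \<subseteq> H n"
proof -
  have "\<exists>n. S \<subseteq> H n"
    using assms
  proof (induction rule: finite_induct)
    case (insert y S)
    then obtain n m where "S \<subseteq> H n" "y \<in> H m" using union_H by auto
    then show ?case using H_mono[of n "max n m"] H_mono[of m "max n m"]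
      by (intro exI[of _ "max n m"]) auto
  qed simp
  then show ?thesis using that by blast
qed

text \<open>Attaching to the newest hub makes all steps inside the end given by \<open>D\<close> hang together in \<open>EF\<close>:
  from the stage \<open>i0\<close> on at which the newest hub seen from the end has the lowest rank, they all
  descend from \<open>Q k\<close>, which lies outside \<open>H n0\<close>.\<close>

lemma end_steps_connected:
  assumes D: "\<And>i. \<exists>z\<in>V - H i. D i = component E (V - H i) z"
    and dec: "\<And>i j. i \<le> j \<Longrightarrow> D j \<subseteq> D i"
  obtains i0 k b where "n0 \<le> i0" "n0 \<le> k" "b \<in> Q k"
    "\<forall>y \<in> Q k \<union> \<Union>{Q j |j. i0 \<le> j \<and> Q j \<subseteq> D j}.
       (b, y) \<in> reach EF (Q k \<union> \<Union>{Q j |j. i0 \<le> j \<and> Q j \<subseteq> D j})"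
proof -
  have Dsub: "D i \<subseteq> V - H i" for i using D[of i] component_subset by metis
  have Dedge: "y' \<in> D i" if "y \<in> D i" "{y, y'} \<in> E" "y' \<notin> H i" for y y' i
    using D[of i] component_edge[of y E "V - H i" _ y'] that edge_in[OF that(2)] by blast
  have Dnewest: "\<exists>u. newest (f i) (D i) u" for i
    using D[of i] newest_exists[OF inv[of i]] unfolding H_def by metis
  have "finite (\<Union>y\<in>H n0. {z. {y, z} \<in> E})" using finite_H finite_neighbours by blast
  moreover have "(\<Union>y\<in>H n0. {z. {y, z} \<in> E}) \<subseteq> V" using edge_in by blast
  ultimately obtain N' where N': "(\<Union>y\<in>H n0. {z. {y, z} \<in> E}) \<subseteq> H N'" by (rule finite_subset_H)
  \<comment> \<open>From stage \<open>N\<close> on, all neighbours of \<open>H n0\<close> are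
    covered, so no remaining component touches \<open>H n0\<close> and the newest hubs seen lie
    outside it.\<close>
  define N where "N = max N' n0"
  have far: "u \<notin> H n0" if nw: "newest (f i) (D i) u" "N \<le> i" for i u
  proof
    assume u: "u \<in> H n0"
    obtain z where z: "z \<in> D i" "{z, u} \<in> E" using nw(1) by (auto simp: newest_def)
    then have "z \<in> H N'" using N' u by (auto simp: insert_commute)
    then have "z \<in> H i" using H_mono[of N' i] nw(2) by (auto simp: N_def)
    then show False using z(1) Dsub by auto
  qed
  \<comment> \<open>\<open>P l\<close> says that rank \<open>l\<close> occurs as a newest rank seen
    from the end at some stage from \<open>N\<close> on; the least such rank singles out
    \<open>i0\<close> and \<open>b\<close>.\<close>
  define P where "P l \<longleftrightarrow> (\<exists>i u. N \<le> i \<and> newest (f i) (D i) u \<and> rank (f i) u = l)" for l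
  have "\<exists>l. P l" using Dnewest[of N] unfolding P_def by blast
  then have "P (LEAST l. P l)" by (rule LeastI_ex)
  then obtain i0 b where i0: "N \<le> i0" "newest (f i0) (D i0) b" "rank (f i0) b = (LEAST l. P l)"
    unfolding P_def by blast
  have least: "rank (f i0) b \<le> rank (f j) u" if "newest (f j) (D j) u" "i0 \<le> j" for j u
  proof -
    have "N \<le> j" using that(2) i0(1) by simp
    then have "P (rank (f j) u)" using that(1) unfolding P_def by blast
    then show ?thesis unfolding i0(3) by (rule Least_le)
  qed
  have "b \<in> H i0" using i0(2) hubs_subset_covered[of c "f i0"] by (auto simp: newest_def H_def)
  then obtain k where k: "n0 \<le> k" "k < i0" "b \<in> Q k" using far[OF i0(2,1)] by (rule H_stages)
  have rb: "rank (f i0) b = Suc k" using rank_Q[OF k(3,2)] .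
  define X where "X = Q k \<union> \<Union>{Q j |j. i0 \<le> j \<and> Q j \<subseteq> D j}"
  have main: "i0 \<le> j \<Longrightarrow> Q j \<subseteq> D j \<Longrightarrow> y \<in> Q j \<Longrightarrow> (b, y) \<in> reach EF X" for j y
  proof (induction j arbitrary: y rule: less_induct)
    case (less j)
    let ?h = "hd (ps j)" and ?a = "anchor j"
    have hQ: "?h \<in> Q j" by (rule Q_nonempty)
    then have hD: "?h \<in> D j" using less.prems by auto
    have he: "{?h, ?a} \<in> E" by (rule ps_facts(4))
    have "D j = component E (V - H j) ?h" using D[of j] hD component_eq by metis
    then have nw: "newest (f j) (D j) ?a" using newest_anchor[of j] by (simp add: H_def)
    have QX: "Q j \<subseteq> X" using less.prems by (auto simp: X_def)
    have "?a \<in> X \<and> (b, ?a) \<in> reach EF X"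
    proof (cases "?a \<in> H i0")
      case True
      \<comment> \<open>The anchor was already a hub next to \<open>D i0\<close>, so its rank is at
        most that of \<open>b\<close>, the newest one there. Minimality gives equality, and equal
        positive rank means that it was added by the same step \<open>k\<close>.\<close>
      then have "?a \<in> U i0" using U_stable[OF less.prems(1) anchor_in_U] by simp
      moreover have "?h \<in> D i0" using dec[OF less.prems(1)] hD by auto
      ultimately have "rank (f i0) ?a \<le> Suc k"
        using i0(2) he rb unfolding newest_def U_def by auto
      then have r: "rank (f i0) ?a = Suc k"
        using least[OF nw less.prems(1)] rb rank_stable[OF True less.prems(1)] by simp
      then have "?a \<notin> H 0" using rank_c[of ?a i0] by (auto simp: H_0)
      with True obtain m where "m < i0" "?a \<in> Q m" by (rule H_stages)
      then have "?a \<in> Q k" using rank_Q[of ?a m i0] r by simp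
      moreover have "(b, ?a) \<in> reach EF X"
        using Q_connected[OF k(3) \<open>?a \<in> Q k\<close>] by (rule reach_mono) (auto simp: X_def)
      ultimately show ?thesis by (simp add: X_def)
    next
      case False
      have "?a \<in> H j" using anchor_in_U U_subset_H by blast
      then obtain m where m: "i0 \<le> m" "m < j" "?a \<in> Q m" using False by (rule H_stages)
      \<comment> \<open>The anchor was added at a step \<open>m\<close> between \<open>i0\<close>
        and \<open>j\<close>. It is uncovered at stage \<open>m\<close> and adjacent to
        \<open>D m\<close>, so step \<open>m\<close> took place inside the end and the induction
        hypothesis applies.\<close>
      have "?a \<in> D m"
        using Dedge[of ?h m ?a] he hD dec[of m j] m Q_facts[of m] by auto
      then have "Q m \<subseteq> D m" using D[of m] Q_component[OF m(3)] by metis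
      then show ?thesis using less.IH[OF m(2,1)] m by (auto simp: X_def)
    qed
    moreover have "{?a, ?h} \<in> EF"
    proof -
      have "walk EF (?a # ps j)" by (auto simp: walk_iff_path_edges EF_def)
      then show ?thesis using ps_facts(2)[of j] by (simp add: walk_Cons)
    qed
    then have "(?a, ?h) \<in> reach EF X" if "?a \<in> X"
      using that QX hQ by (intro reach_edge) auto
    moreover have "(?h, y) \<in> reach EF X"
      using Q_connected[OF hQ less.prems(3)] by (rule reach_mono) (use QX in auto)
    ultimately show ?case by (blast intro: reach_trans)
  qed
  have "(b, y) \<in> reach EF X" if "y \<in> X" for y
  proof (cases "y \<in> Q k")
    case True
    show ?thesis using Q_connected[OF k(3) True] by (rule reach_mono) (auto simp: X_def)
  next
    case False
    then show ?thesis using that main by (auto simp: X_def)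
  qed
  moreover have "n0 \<le> i0" using i0(1) by (simp add: N_def)
  ultimately show ?thesis using that[of i0 k b] k unfolding X_def by blast
qed

section \<open>Ends as nested sequences of components\<close>

definition tail :: "(nat \<Rightarrow> 'a) \<Rightarrow> nat \<Rightarrow> nat" where
  "tail r i = (SOME k. \<forall>m\<ge>k. r m \<notin> H i)"

text \<open>Every finite subset of \<open>V\<close> lies in some \<open>H i\<close>, so these
  components, one for each \<open>i\<close>, determine the end of \<open>r\<close>;
  \<open>rays_equiv_iff_end\<close> makes this precise.\<close>

definition end_of :: "(nat \<Rightarrow> 'a) \<Rightarrow> nat \<Rightarrow> 'a set" where
  "end_of r i = component E (V - H i) (r (tail r i))"

lemma ray_EF: "is_ray V EF r \<Longrightarrow> is_ray V E r"
  using EF_subset by (auto simp: is_ray_def)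

context
  fixes r assumes r: "is_ray V E r"
begin

lemma tail: "m \<ge> tail r i \<Longrightarrow> r m \<in> V - H i"
proof -
  have "inj r" using r by (simp add: is_ray_def)
  then obtain k where "\<And>m. m \<ge> k \<Longrightarrow> r m \<notin> H i" using inj_leaves[OF _ finite_H] by metis
  then have "\<exists>k. \<forall>m\<ge>k. r m \<notin> H i" by blast
  then have "\<forall>m\<ge>tail r i. r m \<notin> H i" unfolding tail_def by (rule someI_ex)
  then show "m \<ge> tail r i \<Longrightarrow> r m \<in> V - H i" using r by (auto simp: is_ray_def)
qed

text \<open>The arbitrary choice in \<open>tail\<close> does not matter: two tails avoiding
  \<open>H i\<close> share vertices, so they lie in the same component.\<close>

lemma in_end:
  assumes "\<And>m. m \<ge> k \<Longrightarrow> r m \<notin> H i"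
  shows "k \<le> m \<Longrightarrow> r m \<in> end_of r i"
proof -
  have 1: "(r m, r m') \<in> reach E (V - H i)" if "k' \<le> m" "k' \<le> m'" "\<And>m. m \<ge> k' \<Longrightarrow> r m \<notin> H i" for k' m m'
    using that r by (intro tail_reach[of r E k']) (auto simp: is_ray_def)
  assume m: "k \<le> m"
  let ?M = "max m (tail r i)"
  have "(r (tail r i), r ?M) \<in> reach E (V - H i)" using tail by (intro 1[of "tail r i"]) auto
  moreover have "(r ?M, r m) \<in> reach E (V - H i)" using m assms by (intro 1[of k]) auto
  ultimately show ?thesis unfolding end_of_def component_def by (blast intro: reach_trans)
qed

lemma in_end_tail: "tail r i \<le> m \<Longrightarrow> r m \<in> end_of r i"
  using in_end[of "tail r i" i m] tail by blast

lemma end_component: "\<exists>z\<in>V - H i. end_of r i = component E (V - H i) z"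
  using tail[of i "tail r i"] by (auto simp: end_of_def)

lemma end_component_eq: "y \<in> end_of r i \<Longrightarrow> end_of r i = component E (V - H i) y"
  unfolding end_of_def by (rule component_eq[symmetric])

lemma end_mono: "i \<le> j \<Longrightarrow> end_of r j \<subseteq> end_of r i"
proof -
  assume ij: "i \<le> j"
  have "r m \<notin> H i" if "m \<ge> tail r j" for m using tail[OF that] H_mono[OF ij] by blast
  then have "r (tail r j) \<in> end_of r i" using in_end[of "tail r j" i "tail r j"] by simp
  then have "end_of r i = component E (V - H i) (r (tail r j))" by (rule end_component_eq)
  moreover have "end_of r j \<subseteq> component E (V - H i) (r (tail r j))"
    unfolding end_of_def by (rule component_mono) (use H_mono[OF ij] in auto)
  ultimately show ?thesis by simp
qed

text \<open>The earliest step that meets the tail of \<open>r\<close> beyond \<open>H i\<close> leaves the whole tail uncovered when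
  it is made, so it is made inside the end of \<open>r\<close>.\<close>

lemma hits_end_step:
  obtains j t where "i \<le> j" "r t \<in> Q j" "Q j \<subseteq> end_of r j" "\<And>m. m \<ge> t \<Longrightarrow> r m \<notin> H i"
proof -
  define k where "k = tail r i"
  define P where "P j \<longleftrightarrow> (\<exists>m\<ge>k. r m \<in> Q j)" for j
  have stage: "\<exists>j\<ge>i. r m \<in> Q j" if "m \<ge> k" for m
  proof -
    have "r m \<in> V - H i" using tail that by (simp add: k_def)
    then obtain n where "r m \<in> H n" "r m \<notin> H i" using union_H by blast
    then show ?thesis using H_stages by metis
  qed
  then have "\<exists>j. P j" unfolding P_def by blast
  define j where "j = (LEAST j. P j)"
  have "P j" unfolding j_def using \<open>\<exists>j. P j\<close> by (rule LeastI_ex)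
  then obtain t where t: "t \<ge> k" "r t \<in> Q j" by (auto simp: P_def)
  have "i \<le> j"
  proof (rule ccontr)
    assume "\<not> i \<le> j"
    then have "r t \<in> H i" using t Q_subset_H[of j i] by auto
    then show False using tail[of i t] t by (auto simp: k_def)
  qed
  have "r m \<notin> H j" if "m \<ge> k" for m
  proof
    assume "r m \<in> H j"
    moreover have "r m \<notin> H i" using tail[of i m] that by (auto simp: k_def)
    ultimately obtain j' where "j' < j" "r m \<in> Q j'" by (rule H_stages)
    then show False using that not_less_Least[of j' P] by (auto simp: j_def P_def)
  qed
  then have "r t \<in> end_of r j" using t(1) in_end[of k j t] by blast
  then have "Q j \<subseteq> end_of r j" unfolding end_of_def by (rule Q_component[OF t(2)])
  moreover have "r m \<notin> H i" if "m \<ge> t" for m using tail[of i m] that t by (auto simp: k_def)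
  ultimately show ?thesis using that \<open>i \<le> j\<close> t(2) by blast
qed

end

lemma rays_equiv_iff_end:
  assumes r: "is_ray V E r" and s: "is_ray V E s"
  shows "rays_equiv V E r s \<longleftrightarrow> (\<forall>i. end_of r i = end_of s i)"
proof
  assume eq: "rays_equiv V E r s"
  show "\<forall>i. end_of r i = end_of s i"
  proof
    fix i
    have "\<exists>k. \<forall>m\<ge>k. \<forall>n\<ge>k. r m \<notin> H i \<and> s n \<notin> H i \<and> (r m, s n) \<in> reach E (V - H i)"
      using eq[unfolded rays_equiv_reach, rule_format, of "H i"] finite_H H_subset_V by simp
    then obtain k where k: "\<forall>m\<ge>k. \<forall>n\<ge>k. (r m, s n) \<in> reach E (V - H i)" by metis
    define m where "m = max k (max (tail r i) (tail s i))"
    have rs: "r m \<in> end_of r i" "s m \<in> end_of s i"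
      using in_end_tail[OF r] in_end_tail[OF s] by (simp_all add: m_def)
    have "(r m, s m) \<in> reach E (V - H i)" using k by (simp add: m_def)
    then have "s m \<in> end_of r i" using end_component_eq[OF r rs(1)] by (simp add: component_def)
    then show "end_of r i = end_of s i"
      using end_component_eq[OF r] end_component_eq[OF s rs(2)] by metis
  qed
next
  assume eq: "\<forall>i. end_of r i = end_of s i"
  show "rays_equiv V E r s"
    unfolding rays_equiv_reach
  proof (intro allI impI)
    fix S assume S: "finite S \<and> S \<subseteq> V"
    then obtain i where i: "S \<subseteq> H i" using finite_subset_H by blast
    show "\<exists>k. \<forall>m\<ge>k. \<forall>n\<ge>k. r m \<notin> S \<and> s n \<notin> S \<and> (r m, s n) \<in> reach E (V - S)"
    proof (intro exI[of _ "max (tail r i) (tail s i)"] allI impI)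
      fix m n assume m: "max (tail r i) (tail s i) \<le> m" and n: "max (tail r i) (tail s i) \<le> n"
      have "r m \<in> end_of r i" "s n \<in> end_of r i"
        using in_end_tail[OF r] in_end_tail[OF s] eq m n by simp_all
      then have "(r m, s n) \<in> reach E (V - H i)"
        using end_component_eq[OF r] by (auto simp: component_def)
      then have "(r m, s n) \<in> reach E (V - S)" by (rule reach_mono) (use i in auto)
      then show "r m \<notin> S \<and> s n \<notin> S \<and> (r m, s n) \<in> reach E (V - S)"
        using tail[OF r, of i m] tail[OF s, of i n] i m n by auto
    qed
  qed
qed

text \<open>Koenig's lemma is applied to the connected set formed by \<open>Q k\<close> and the late
  steps inside the end of \<open>r\<close>. A ray in this set leaves every \<open>H i\<close>, so it
  runs through ever later of these steps and belongs to the same end.\<close>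

lemma ray_in_end:
  assumes r: "is_ray V E r"
  obtains s where "is_ray V EF s" "rays_equiv V E r s"
proof -
  obtain i0 k b where b: "b \<in> Q k" and conn: "\<forall>y \<in> Q k \<union> \<Union>{Q j |j. i0 \<le> j \<and> Q j \<subseteq> end_of r j}.
       (b, y) \<in> reach EF (Q k \<union> \<Union>{Q j |j. i0 \<le> j \<and> Q j \<subseteq> end_of r j})"
    by (rule end_steps_connected[of "end_of r" 0, OF end_component[OF r] end_mono[OF r]])
  define X where "X = Q k \<union> \<Union>{Q j |j. i0 \<le> j \<and> Q j \<subseteq> end_of r j}"
  have XV: "X \<subseteq> V" using Q_facts by (fastforce simp: X_def)
  \<comment> \<open>The ray \<open>r\<close> forces steps inside its end at arbitrarily late stages,
    and each of them covers a new vertex.\<close>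
  have "infinite X"
  proof
    assume "finite X"
    then obtain M where M: "X \<subseteq> H M" using XV by (rule finite_subset_H)
    obtain j where j: "max M i0 \<le> j" "Q j \<subseteq> end_of r j" by (rule hits_end_step[OF r])
    then have "Q j \<subseteq> X" by (auto simp: X_def)
    then have "Q j \<subseteq> H j" using M H_mono[of M j] j(1) by auto
    then show False using Q_nonempty[of j] Q_facts[of j] by auto
  qed
  moreover have "b \<in> X" using b by (simp add: X_def)
  moreover have "\<forall>y\<in>X. (b, y) \<in> reach EF X" using conn unfolding X_def .
  moreover have "finite {z. {y, z} \<in> EF}" for y
    by (rule finite_subset[OF _ finite_neighbours[of y]]) (use EF_subset in auto)
  ultimately obtain s where s: "inj s" "\<forall>n. s n \<in> X" "\<forall>n. {s n, s (Suc n)} \<in> EF"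
    by (rule konig_ray)
  have sF: "is_ray V EF s" using s XV by (auto simp: is_ray_def)
  then have sE: "is_ray V E s" by (rule ray_EF)
  have "end_of r i = end_of s i" for i
  proof -
    \<comment> \<open>Beyond this stage a vertex of \<open>s\<close> can no longer lie in
      \<open>Q k\<close>, and its step comes after both \<open>i\<close> and
      \<open>i0\<close>.\<close>
    define i' where "i' = max (max i i0) (Suc k)"
    define m where "m = max (tail s i) (tail s i')"
    have m: "s m \<in> end_of s i" "s m \<notin> H i'"
      using in_end_tail[OF sE, of i m] tail[OF sE, of i' m] by (auto simp: m_def)
    have "k < i'" by (simp add: i'_def)
    then have "s m \<notin> Q k" using m(2) Q_subset_H by blast
    then obtain j where j: "s m \<in> Q j" "i0 \<le> j" "Q j \<subseteq> end_of r j" using s(2)[rule_format, of m] by (auto simp: X_def)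
    have "i' \<le> j" using m(2) j(1) Q_subset_H[of j i'] by (meson not_le subsetD)
    then have "s m \<in> end_of r i" using end_mono[OF r, of i j] j by (auto simp: i'_def)
    then show ?thesis using end_component_eq[OF r] end_component_eq[OF sE m(1)] by metis
  qed
  then have "rays_equiv V E r s" using rays_equiv_iff_end[OF r sE] by blast
  then show ?thesis using that sF by blast
qed

text \<open>The vertex \<open>b\<close> is a common hook: both rays have the same sequence of
  components, so each meets a step contained in \<open>X\<close>, which is connected to
  \<open>b\<close> in \<open>EF\<close>. As \<open>X\<close> arises only from stage
  \<open>n0\<close> on, it avoids \<open>H n0\<close> and thus \<open>S\<close>.\<close>

lemma EF_rays_equiv:
  assumes r: "is_ray V EF r" and s: "is_ray V EF s" and eq: "rays_equiv V E r s"
  shows "rays_equiv V EF r s"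
  unfolding rays_equiv_reach
proof (intro allI impI)
  fix S assume S: "finite S \<and> S \<subseteq> V"
  then obtain n0 where n0: "S \<subseteq> H n0" using finite_subset_H by blast
  have rE: "is_ray V E r" and sE: "is_ray V E s" using r s ray_EF by auto
  obtain i0 k b where i0: "n0 \<le> i0" "n0 \<le> k"
    and conn: "\<forall>y \<in> Q k \<union> \<Union>{Q j |j. i0 \<le> j \<and> Q j \<subseteq> end_of r j}.
       (b, y) \<in> reach EF (Q k \<union> \<Union>{Q j |j. i0 \<le> j \<and> Q j \<subseteq> end_of r j})"
    by (rule end_steps_connected[of "end_of r" n0, OF end_component[OF rE] end_mono[OF rE]])
  define X where "X = Q k \<union> \<Union>{Q j |j. i0 \<le> j \<and> Q j \<subseteq> end_of r j}"
  have late: "Q j \<subseteq> V - S" if "n0 \<le> j" for j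
    using Q_facts[of j] H_mono[OF that] n0 by blast
  then have XS: "X \<subseteq> V - S" using i0 le_trans unfolding X_def by blast
  have hook: "\<exists>t. \<forall>m\<ge>t. r' m \<notin> S \<and> (b, r' m) \<in> reach EF (V - S)"
    if r': "is_ray V EF r'" and same: "\<forall>i. end_of r i = end_of r' i" for r'
  proof -
    obtain j t where jt: "i0 \<le> j" "r' t \<in> Q j" "Q j \<subseteq> end_of r' j" "\<And>m. m \<ge> t \<Longrightarrow> r' m \<notin> H i0"
      using hits_end_step[OF ray_EF[OF r'], of i0] by metis
    have "r' t \<in> X" using jt same by (auto simp: X_def)
    then have "(b, r' t) \<in> reach EF X" using conn unfolding X_def by (rule bspec[rotated])
    then have bt: "(b, r' t) \<in> reach EF (V - S)" by (rule reach_mono) (use XS in auto)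
    have out: "r' m \<in> V - S" if "m \<ge> t" for m
      using jt(4)[OF that] r' n0 H_mono[OF i0(1)] by (auto simp: is_ray_def)
    have "(r' t, r' m) \<in> reach EF (V - S)" if "m \<ge> t" for m
      using that r' out by (intro tail_reach[of r' EF t]) (auto simp: is_ray_def)
    then show ?thesis using bt out by (blast intro: reach_trans)
  qed
  obtain t1 where t1: "\<forall>m\<ge>t1. r m \<notin> S \<and> (b, r m) \<in> reach EF (V - S)" using hook[OF r] by blast
  obtain t2 where t2: "\<forall>m\<ge>t2. s m \<notin> S \<and> (b, s m) \<in> reach EF (V - S)"
    using hook[OF s] eq rays_equiv_iff_end[OF rE sE] by blast
  show "\<exists>k. \<forall>m\<ge>k. \<forall>n\<ge>k. r m \<notin> S \<and> s n \<notin> S \<and> (r m, s n) \<in> reach EF (V - S)"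
  proof (intro exI[of _ "max t1 t2"] allI impI)
    fix m n assume "max t1 t2 \<le> m" "max t1 t2 \<le> n"
    then have "r m \<notin> S" "(b, r m) \<in> reach EF (V - S)" "s n \<notin> S" "(b, s n) \<in> reach EF (V - S)"
      using t1 t2 by auto
    then show "r m \<notin> S \<and> s n \<notin> S \<and> (r m, s n) \<in> reach EF (V - S)"
      by (blast intro: reach_trans[OF reach_sym])
  qed
qed

lemma EF_faithful: "faithful V EF V E"
  unfolding faithful_def
proof (intro conjI allI impI)
  show "\<exists>s. is_ray V EF s \<and> rays_equiv V E r s" if "is_ray V E r" for r
    using ray_in_end[OF that] by blast
  fix r s assume rs: "is_ray V EF r \<and> is_ray V EF s"
  show "rays_equiv V EF r s \<longleftrightarrow> rays_equiv V E r s"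
  proof
    assume "rays_equiv V EF r s"
    then show "rays_equiv V E r s"
      unfolding rays_equiv_reach using reach_mono[OF _ EF_subset order_refl] by meson
  qed (use EF_rays_equiv rs in blast)
qed

end

theorem theorem7:
  fixes V :: "'a set" and E :: "'a set set"
  assumes "graph V E" and "infinite V" and "two_connected V E" and "subcubic V E"
  shows "\<exists>EF. EF \<subseteq> E \<and> cactus V EF \<and> faithful V EF V E"
proof -
  interpret infinite_subcubic V E using assms by unfold_locales
  obtain c where c: "circuit E c" "set c \<subseteq> V" by (rule circuit_exists)
  interpret cactus_process V E c using c by unfold_locales
  obtain f where f: "f 0 = []" "\<forall>n. invariant (f n)"
    "\<forall>n. \<exists>q. f (Suc n) = q # f n \<and> attach (f n) q" "V = (\<Union>n. covered c (f n))"
    by (rule process)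
  interpret cactus_limit V E c f by (unfold_locales; use f in blast)
  show ?thesis using EF_subset EF_cactus EF_faithful by blast
qed

end
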